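(* Let $\Sigma$ be a finite alphabet, $w$ a positive integer, and $\tau=(R_1,\dots,R_m)$ a relational vocabulary, where $R_i$ has arity $a_i$. For every first-order sentence $\varphi$ over $\tau$, the relation $$\mathcal{R}(\Sigma,w,\tau,\varphi)=\{(D_0,D_1,\dots,D_m)\in\mathcal{R}(\Sigma,w,\tau)\;:\;\mathcal{S}(D_0,\dots,D_m)\models\varphi\}$$ is regular.
   Context: Padding and tensor products. Fix a padding symbol $\#$ not in any alphabet considered. For alphabets $\Gamma_1,\dots,\Gamma_a$, $\Gamma_1\otimes\cdots\otimes\Gamma_a$ is the Cartesian product $\Gamma_1\times\cdots\times\Gamma_a$ regarded as an alphabet, and $\Gamma^{\otimes a}$ is the $a$-fold product of $\Gamma$. For nonempty strings $u_i$ over $\Gamma_i$ of lengths $n_i$ ($i\in[a]$), $u_1\otimes\cdots\otimes u_a$ is the string of length $n=\max_i n_i$ over $(\Gamma_1\sqcup\{\#\})\otimes\cdots\otimes(\Gamma_a\sqcup\{\#\})$ whose $j$-th symbol is $(\hat\sigma_{1,j},\dots,\hat\sigma_{a,j})$, where $\hat\sigma_{i,j}$ is the $j$-th symbol of $u_i$ if $j\le n_i$ and $\#$ otherwise. For languages $L_1,\dots,L_a$ of nonempty strings, $L_1\otimes\cdots\otimes L_a=\{u_1\otimes\cdots\otimes u_a: u_i\in L_i\}$, and $L^{\otimes a}$ is the $a$-fold such product. For a language $L$ of strings over a tensor-product alphabet, $\mathcal{R}(L)=\{(u_1,\dots,u_a): u_1\otimes\cdots\otimes u_a\in L\}$. A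 relation $R\subseteq\Gamma_1^+\times\cdots\times\Gamma_a^+$ is regular if the language $\{u_1\otimes\cdots\otimes u_a:(u_1,\dots,u_a)\in R\}$ is accepted by some finite automaton. Ordered decision diagrams (ODDs). For an alphabet $\Sigma$ and $w\ge1$, a $(\Sigma,w)$-layer is a tuple $B=(\ell,r,T,I,F,\iota,\phi)$ with $\ell,r\subseteq\{0,\dots,w-1\}$, $T\subseteq\ell\times(\Sigma\sqcup\{\#\})\times r$, $I\subseteq\ell$, $F\subseteq r$, $\iota,\phi\in\{\mathrm{true},\mathrm{false}\}$, such that $I=\emptyset$ if $\iota=\mathrm{false}$ and $F=\emptyset$ if $\phi=\mathrm{false}$. The finite set of all $(\Sigma,w)$-layers is denoted $\mathcal{B}(\Sigma,w)$ and regarded as an alphabet. A $(\Sigma,w)$-ODD of length $k\ge1$ is a string $D=B_1\cdots B_k$ over $\mathcal{B}(\Sigma,w)$ such that $\ell(B_{i+1})=r(B_i)$ for $i\in[k-1]$; $\iota(B_1)=\mathrm{true}$ and $\iota(B_i)=\mathrm{false}$ for $i\ge2$; $\phi(B_k)=\mathrm{true}$ and $\phi(B_i)=\mathrm{false}$ for $i<k$. $\mathcal{B}(\Sigma,w,k)$ is the set of such ODDs. A nonempty string $s=\sigma_1\cdots\sigma_{k'}$ over $\Sigma$ with $k'\le k$ is accepted by $D$ if, with $\hat\sigma_i=\sigma_i$ for $i\le k'$ and $\hat\sigma_i=\#$ for $i>k'$, there are transitions $(p_i,\hat\sigma_i,q_i)\in T(B_i)$ for $i\in[k]$ with $p_{i+1}=q_i$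 for $i<k$, $p_1\in I(B_1)$ and $q_k\in F(B_k)$. $L(D)$ is the set of strings accepted by $D$. ODDs over $\Sigma^{\otimes a}$ are defined in the same way with alphabet $\Sigma^{\otimes a}$. Structures. A relational vocabulary $\tau=(R_1,\dots,R_m)$ has arities $a_i\ge1$; a finite $\tau$-structure has a nonempty finite domain and an $a_i$-ary relation for each $R_i$. A tuple $(D_0,\dots,D_m)$ is $(\Sigma,w,\tau)$-structural if there is $k\ge1$ (its length) with $D_0\in\mathcal{B}(\Sigma,w,k)$, $D_i\in\mathcal{B}(\Sigma^{\otimes a_i},w,k)$ and $L(D_i)\subseteq L(D_0)^{\otimes a_i}$ for all $i\in[m]$. Its derived structure $\mathcal{S}(D_0,\dots,D_m)$ is the $\tau$-structure with domain $L(D_0)$ in which $R_i$ is interpreted as $\mathcal{R}(L(D_i))$. $\mathcal{R}(\Sigma,w,\tau)$ denotes the set of all $(\Sigma,w,\tau)$-structural tuples; it is viewed as a relation whose $0$-th coordinate lies in $\mathcal{B}(\Sigma,w)^+$ and $i$-th coordinate in $\mathcal{B}(\Sigma^{\otimes a_i},w)^+$. *)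

theory Defs
  imports Main
begin

section \<open>Padding and tensor products\<close>

text \<open>
  The padding symbol is \<open>None\<close>. Tuples are lists, so the Cartesian product of
  \<open>\<Gamma>\<^sub>1, \<dots>, \<Gamma>\<^sub>a\<close> is \<open>listset [\<Gamma>\<^sub>1, \<dots>, \<Gamma>\<^sub>a]\<close>.
\<close>

definition pad_alphabet :: "'g set \<Rightarrow> 'g option set" where
  "pad_alphabet \<Gamma> = insert None (Some ` \<Gamma>)"

definition plus_strings :: "'g set \<Rightarrow> 'g list set" where
  "plus_strings \<Gamma> = lists \<Gamma> - {[]}"

definition padded_nth :: "'g list \<Rightarrow> nat \<Rightarrow> 'g option" where
  "padded_nth u j = (if j < length u then Some (u ! j) else None)"

text \<open>Only meaningful for a nonempty tuple \<open>us\<close> of nonempty strings.\<close>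

definition tensor :: "'g list list \<Rightarrow> 'g option list list" where
  "tensor us = map (\<lambda>j. map (\<lambda>u. padded_nth u j) us) [0..<Max (length ` set us)]"

definition tensor_alphabet :: "'g set list \<Rightarrow> 'g list set" where
  "tensor_alphabet \<Gamma>s = listset \<Gamma>s"

definition tensor_power_alphabet :: "'g set \<Rightarrow> nat \<Rightarrow> 'g list set" where
  "tensor_power_alphabet \<Gamma> a = tensor_alphabet (replicate a \<Gamma>)"

definition tensor_language :: "'g list set list \<Rightarrow> 'g option list list set" where
  "tensor_language Ls = tensor ` listset Ls"

definition tensor_power_language :: "'g list set \<Rightarrow> nat \<Rightarrow> 'g option list list set" where
  "tensor_power_language L a = tensor_language (replicate a L)"

definition relation_of :: "nat \<Rightarrow> 'g option list list set \<Rightarrow> 'g list list set" where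
  "relation_of a L = {us. length us = a \<and> [] \<notin> set us \<and> tensor us \<in> L}"


section \<open>Finite automata and regular relations\<close>

fun nfa_reach :: "('q \<times> 's \<times> 'q) set \<Rightarrow> 'q set \<Rightarrow> 's list \<Rightarrow> 'q set" where
  "nfa_reach \<Delta> S [] = S"
| "nfa_reach \<Delta> S (x # xs) = nfa_reach \<Delta> {q. \<exists>p\<in>S. (p, x, q) \<in> \<Delta>} xs"

text \<open>
  Taking natural numbers as states is no restriction, as the state set is finite.
\<close>

definition fa_recognizable :: "'s set \<Rightarrow> 's list set \<Rightarrow> bool" where
  "fa_recognizable A L \<longleftrightarrow>
     (\<exists>(Q :: nat set) \<Delta> I F.
        finite Q \<and> \<Delta> \<subseteq> Q \<times> A \<times> Q \<and> I \<subseteq> Q \<and> F \<subseteq> Q \<and>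
        L = {xs \<in> lists A. nfa_reach \<Delta> I xs \<inter> F \<noteq> {}})"

definition regular_relation :: "'g set list \<Rightarrow> 'g list list set \<Rightarrow> bool" where
  "regular_relation \<Gamma>s R \<longleftrightarrow>
     R \<subseteq> listset (map plus_strings \<Gamma>s) \<and>
     fa_recognizable (tensor_alphabet (map pad_alphabet \<Gamma>s)) (tensor ` R)"


section \<open>Ordered decision diagrams\<close>

record 'b layer =
  lleft :: "nat set"
  lright :: "nat set"
  ltrans :: "(nat \<times> 'b option \<times> nat) set"
  linit :: "nat set"
  lfinal :: "nat set"
  liflag :: bool
  lfflag :: bool

definition layers :: "'b set \<Rightarrow> nat \<Rightarrow> 'b layer set" where
  "layers \<Sigma> w = {B.
     lleft B \<subseteq> {0..<w} \<and> lright B \<subseteq> {0..<w} \<and>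
     ltrans B \<subseteq> lleft B \<times> pad_alphabet \<Sigma> \<times> lright B \<and>
     linit B \<subseteq> lleft B \<and> lfinal B \<subseteq> lright B \<and>
     (\<not> liflag B \<longrightarrow> linit B = {}) \<and> (\<not> lfflag B \<longrightarrow> lfinal B = {})}"

definition odds :: "'b set \<Rightarrow> nat \<Rightarrow> nat \<Rightarrow> 'b layer list set" where
  "odds \<Sigma> w k = {D \<in> lists (layers \<Sigma> w).
     length D = k \<and> 1 \<le> k \<and>
     (\<forall>i. Suc i < k \<longrightarrow> lleft (D ! Suc i) = lright (D ! i)) \<and>
     (\<forall>i<k. liflag (D ! i) \<longleftrightarrow> i = 0) \<and>
     (\<forall>i<k. lfflag (D ! i) \<longleftrightarrow> i = k - 1)}"

definition odd_accepts :: "'b layer list \<Rightarrow> 'b list \<Rightarrow> bool" where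
  "odd_accepts D s \<longleftrightarrow>
     s \<noteq> [] \<and> length s \<le> length D \<and>
     (\<exists>p q.
        (\<forall>i<length D. (p i, padded_nth s i, q i) \<in> ltrans (D ! i)) \<and>
        (\<forall>i. Suc i < length D \<longrightarrow> p (Suc i) = q i) \<and>
        p 0 \<in> linit (D ! 0) \<and> q (length D - 1) \<in> lfinal (D ! (length D - 1)))"

definition odd_language :: "'b layer list \<Rightarrow> 'b list set" where
  "odd_language D = {s. odd_accepts D s}"


section \<open>First-order logic\<close>

text \<open>
  A vocabulary is the list \<open>ar\<close> of its arities; relation symbols are the indices
  \<open>i < length ar\<close>. Variables are natural numbers.
\<close>

datatype fo =
    Eq nat nat
  | Rel nat "nat list"
  | Neg fo
  | Conj fo fo
  | Disj fo fo
  | Exists nat fo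
  | Forall nat fo

fun fo_over :: "nat list \<Rightarrow> fo \<Rightarrow> bool" where
  "fo_over ar (Eq x y) \<longleftrightarrow> True"
| "fo_over ar (Rel i xs) \<longleftrightarrow> i < length ar \<and> length xs = ar ! i"
| "fo_over ar (Neg f) \<longleftrightarrow> fo_over ar f"
| "fo_over ar (Conj f g) \<longleftrightarrow> fo_over ar f \<and> fo_over ar g"
| "fo_over ar (Disj f g) \<longleftrightarrow> fo_over ar f \<and> fo_over ar g"
| "fo_over ar (Exists x f) \<longleftrightarrow> fo_over ar f"
| "fo_over ar (Forall x f) \<longleftrightarrow> fo_over ar f"

fun free_vars :: "fo \<Rightarrow> nat set" where
  "free_vars (Eq x y) = {x, y}"
| "free_vars (Rel i xs) = set xs"
| "free_vars (Neg f) = free_vars f"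
| "free_vars (Conj f g) = free_vars f \<union> free_vars g"
| "free_vars (Disj f g) = free_vars f \<union> free_vars g"
| "free_vars (Exists x f) = free_vars f - {x}"
| "free_vars (Forall x f) = free_vars f - {x}"

definition fo_sentence :: "nat list \<Rightarrow> fo \<Rightarrow> bool" where
  "fo_sentence ar \<phi> \<longleftrightarrow> fo_over ar \<phi> \<and> free_vars \<phi> = {}"

record 'u struct =
  domain :: "'u set"
  interp :: "'u list set list"

definition finite_structure :: "nat list \<Rightarrow> 'u struct \<Rightarrow> bool" where
  "finite_structure ar S \<longleftrightarrow>
     finite (domain S) \<and> domain S \<noteq> {} \<and> length (interp S) = length ar \<and>
     (\<forall>i<length ar. interp S ! i \<subseteq> listset (replicate (ar ! i) (domain S)))"

fun sat :: "'u struct \<Rightarrow> (nat \<Rightarrow> 'u) \<Rightarrow> fo \<Rightarrow> bool" where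
  "sat S v (Eq x y) \<longleftrightarrow> v x = v y"
| "sat S v (Rel i xs) \<longleftrightarrow> map v xs \<in> interp S ! i"
| "sat S v (Neg f) \<longleftrightarrow> \<not> sat S v f"
| "sat S v (Conj f g) \<longleftrightarrow> sat S v f \<and> sat S v g"
| "sat S v (Disj f g) \<longleftrightarrow> sat S v f \<or> sat S v g"
| "sat S v (Exists x f) \<longleftrightarrow> (\<exists>u\<in>domain S. sat S (v(x := u)) f)"
| "sat S v (Forall x f) \<longleftrightarrow> (\<forall>u\<in>domain S. sat S (v(x := u)) f)"

text \<open>
  Structures have nonempty domains, so a derived structure with empty domain
  models no sentence.
\<close>

definition models :: "nat list \<Rightarrow> 'u struct \<Rightarrow> fo \<Rightarrow> bool" where
  "models ar S \<phi> \<longleftrightarrow>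
     finite_structure ar S \<and> (\<forall>v. range v \<subseteq> domain S \<longrightarrow> sat S v \<phi>)"


section \<open>Structural tuples\<close>

text \<open>
  Tensor products of strings over \<open>\<Sigma>\<close> are strings over tuples of optional symbols, so
  the diagrams \<open>D\<^sub>1, \<dots>, D\<^sub>m\<close> read symbols of type \<open>'a option list\<close>. The parameter \<open>C\<close> is
  the set of components allowed in these tuples: for \<open>C = Some ` \<Sigma>\<close> the diagram \<open>D\<^sub>i\<close> is
  over \<open>\<Sigma>\<^sup>\<otimes>\<^sup>a\<close> taken literally (which only represents tuples of strings of equal length),
  for \<open>C = pad_alphabet \<Sigma>\<close> it is over the \<open>a\<close>-fold product of the padded alphabet (which
  also represents tuples of strings of different lengths).
\<close>

definition structural ::
    "'a option set \<Rightarrow> 'a set \<Rightarrow> nat \<Rightarrow> nat list \<Rightarrow>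
     ('a layer list \<times> 'a option list layer list list) set" where
  "structural C \<Sigma> w ar = {(D0, Ds). length Ds = length ar \<and>
     (\<exists>k\<ge>1. D0 \<in> odds \<Sigma> w k \<and>
        (\<forall>i<length ar.
           Ds ! i \<in> odds (tensor_power_alphabet C (ar ! i)) w k \<and>
           odd_language (Ds ! i) \<subseteq> tensor_power_language (odd_language D0) (ar ! i)))}"

definition derived_structure ::
    "nat list \<Rightarrow> 'a layer list \<times> 'a option list layer list list \<Rightarrow> 'a list struct" where
  "derived_structure ar = (\<lambda>(D0, Ds).
     \<lparr> domain = odd_language D0,
       interp = map2 (\<lambda>a D. relation_of a (odd_language D)) ar Ds \<rparr>)"

definition structural_models ::
    "'a option set \<Rightarrow> 'a set \<Rightarrow> nat \<Rightarrow> nat list \<Rightarrow> fo \<Rightarrow>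
     ('a layer list \<times> 'a option list layer list list) set" where
  "structural_models C \<Sigma> w ar \<phi> =
     {D \<in> structural C \<Sigma> w ar. models ar (derived_structure ar D) \<phi>}"

text \<open>
  The coordinates of a structural tuple are strings over alphabets of two different
  types; the disjoint sum makes them strings over one type.
\<close>

type_synonym 'a layer_symbol = "'a layer + 'a option list layer"

definition tuple_strings ::
    "'a layer list \<times> 'a option list layer list list \<Rightarrow> 'a layer_symbol list list" where
  "tuple_strings = (\<lambda>(D0, Ds). map Inl D0 # map (map Inr) Ds)"

definition coordinate_alphabets ::
    "'a option set \<Rightarrow> 'a set \<Rightarrow> nat \<Rightarrow> nat list \<Rightarrow> 'a layer_symbol set list" where
  "coordinate_alphabets C \<Sigma> w ar =
     Inl ` layers \<Sigma> w # map (\<lambda>a. Inr ` layers (tensor_power_alphabet C a) w) ar"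

end

theory Submission imports Defs begin

text \<open>
  By Myhill and Nerode, a language is regular iff it has finitely many left quotients, and this
  property is visibly preserved by Boolean operations and by inverse and direct images under letter
  maps. Since all diagrams of a structural tuple have the same length \<open>k\<close> and accept only strings of
  length at most \<open>k\<close>, a tuple together with a valuation of all variables is a single word of length
  \<open>k\<close>, with one track for the layers and one track per variable for its padded value. Acceptance by
  a diagram of width \<open>w\<close> depends on a prefix only through a subset of \<open>{0..<w}\<close>, so atomic formulas
  define languages with finitely many quotients, and a quantifier erases a track.
  The inclusions \<open>L(D\<^sub>i) \<subseteq> L(D\<^sub>0)\<^sup>\<otimes>\<^sup>a\<close> are treated in the same way. Quotients
  make no reference to the alphabet, so infinitely many tracks do no harm.
\<close>

subsection \<open>Languages with finitely many left quotients\<close>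

definition fin_quot :: "'s list set \<Rightarrow> bool" where
  "fin_quot L \<longleftrightarrow> finite (range (\<lambda>u. {v. u @ v \<in> L}))"

text \<open>The members of \<open>\<F>\<close> act as the states of a deterministic automaton and
  one-letter quotients as its transitions; induction on the prefix keeps every quotient of
  \<open>L\<close> inside \<open>\<F>\<close>. Languages not obtained by closure properties are
  treated by listing such a family.\<close>

lemma fin_quot_family:
  assumes "finite \<F>" "L \<in> \<F>" "\<And>K x. K \<in> \<F> \<Longrightarrow> {v. x # v \<in> K} \<in> \<F>"
  shows "fin_quot L"
proof -
  have "{v. u @ v \<in> K} \<in> \<F>" if "K \<in> \<F>" for u K
    using that
  proof (induction u arbitrary: K)
    case (Cons x u)
    show ?case using Cons.IH[OF assms(3)[OF Cons.prems, of x]] by simp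
  qed simp
  then have "range (\<lambda>u. {v. u @ v \<in> L}) \<subseteq> \<F>"
    using assms(2) by auto
  then show ?thesis
    unfolding fin_quot_def using assms(1) finite_subset by blast
qed

lemma fin_quot_compl:
  assumes "fin_quot L" shows "fin_quot (- L)"
proof -
  have "range (\<lambda>u. {v. u @ v \<in> - L}) = uminus ` range (\<lambda>u. {v. u @ v \<in> L})"
    unfolding image_image by (rule image_cong) auto
  then show ?thesis using assms unfolding fin_quot_def by simp
qed

lemma fin_quot_inter:
  assumes "fin_quot L" "fin_quot M" shows "fin_quot (L \<inter> M)"
proof -
  have "range (\<lambda>u. {v. u @ v \<in> L \<inter> M}) \<subseteq>
      (\<lambda>(X, Y). X \<inter> Y) ` (range (\<lambda>u. {v. u @ v \<in> L}) \<times> range (\<lambda>u. {v. u @ v \<in> M}))"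
    by (force simp: image_iff)
  then show ?thesis using assms unfolding fin_quot_def
    by (meson finite_SigmaI finite_imageI finite_subset)
qed

lemma fin_quot_UNIV: "fin_quot UNIV"
  by (rule fin_quot_family[of "{UNIV}"]) auto

lemma fin_quot_INT:
  assumes "finite I" "\<And>i. i \<in> I \<Longrightarrow> fin_quot (L i)"
  shows "fin_quot (\<Inter>i\<in>I. L i)"
  using assms by (induction I) (auto intro: fin_quot_inter fin_quot_UNIV)

lemma fin_quot_vimage:
  assumes "fin_quot L" shows "fin_quot {xs. map h xs \<in> L}"
proof -
  have "range (\<lambda>u. {v. u @ v \<in> {xs. map h xs \<in> L}}) \<subseteq>
      (\<lambda>X. {v. map h v \<in> X}) ` range (\<lambda>u. {v. u @ v \<in> L})"
    by (force simp: image_iff)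
  then show ?thesis using assms unfolding fin_quot_def
    by (meson finite_imageI finite_subset)
qed

text \<open>This is the subset construction: a quotient of the image by \<open>u\<close> is
  determined by the set of quotients of \<open>L\<close> by the words that \<open>h\<close> maps to
  \<open>u\<close>, and a finite collection of quotients has only finitely many subsets.\<close>

lemma fin_quot_image:
  assumes "fin_quot L" shows "fin_quot (map h ` L)"
proof -
  define q where "q u = {v. u @ v \<in> L}" for u
  have "{v. u @ v \<in> map h ` L} = (\<Union>X\<in>q ` {u'. map h u' = u}. map h ` X)" for u
  proof (intro set_eqI iffI)
    fix v assume "v \<in> {v. u @ v \<in> map h ` L}"
    then obtain x where x: "x \<in> L" "map h x = u @ v" by (metis imageE mem_Collect_eq)
    then obtain u' v' where "x = u' @ v'" "map h u' = u" "map h v' = v"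
      by (metis map_eq_append_conv)
    then show "v \<in> (\<Union>X\<in>q ` {u'. map h u' = u}. map h ` X)"
      using x(1) by (intro UN_I[of "q u'"]) (auto simp: q_def)
  next
    fix v assume "v \<in> (\<Union>X\<in>q ` {u'. map h u' = u}. map h ` X)"
    then obtain u' v' where "map h u' = u" "u' @ v' \<in> L" "v = map h v'"
      by (auto simp: q_def)
    then show "v \<in> {v. u @ v \<in> map h ` L}"
      using image_eqI[of "u @ v" "map h" "u' @ v'" L] by simp
  qed
  then have "range (\<lambda>u. {v. u @ v \<in> map h ` L}) \<subseteq> (\<lambda>\<X>. \<Union>X\<in>\<X>. map h ` X) ` Pow (range q)"
    by (simp only:) (rule image_subsetI, rule imageI, blast)
  moreover have "finite (range q)" using assms unfolding fin_quot_def q_def .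
  ultimately show ?thesis unfolding fin_quot_def
    by (meson finite_Pow_iff finite_imageI finite_subset)
qed

lemma fin_quot_lists: "fin_quot (lists A)"
proof (rule fin_quot_family[of "{lists A, {}}"])
  fix K x assume "K \<in> {lists A, {}}"
  moreover have "{v. x # v \<in> lists A} = (if x \<in> A then lists A else {})" by auto
  ultimately show "{v. x # v \<in> K} \<in> {lists A, {}}"
    by (elim insertE emptyE) simp_all
qed auto

text \<open>The states of the automaton are the quotients, numbered by an injection \<open>f\<close>
  because states are natural numbers; a quotient is final when it contains the empty word.\<close>

lemma fin_quot_imp_fa_recognizable:
  assumes "fin_quot L" "L \<subseteq> lists A"
  shows "fa_recognizable A L"
proof -
  define R where "R = range (\<lambda>u. {v. u @ v \<in> L})"
  have "finite R" using assms(1) unfolding R_def fin_quot_def .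
  then obtain f :: "_ \<Rightarrow> nat" where f: "inj_on f R"
    using finite_imp_inj_to_nat_seg by blast
  have R_deriv: "{v. x # v \<in> K} \<in> R" if "K \<in> R" for K x
  proof -
    from that obtain u where "K = {v. u @ v \<in> L}" unfolding R_def by auto
    then have "{v. x # v \<in> K} = {v. (u @ [x]) @ v \<in> L}" by simp
    then show ?thesis unfolding R_def by blast
  qed
  have "L \<in> R" unfolding R_def by (rule range_eqI[of _ _ "[]"]) simp
  define \<Delta> where "\<Delta> = {(f K, x, f {v. x # v \<in> K}) | K x. K \<in> R \<and> x \<in> A}"
  define F where "F = f ` {K \<in> R. [] \<in> K}"
  have reach: "nfa_reach \<Delta> {f K} xs = {f {v. xs @ v \<in> K}}" if "K \<in> R" "xs \<in> lists A" for K xs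
    using that
  proof (induction xs arbitrary: K)
    case (Cons x xs)
    \<comment> \<open>Injectivity of \<open>f\<close> makes \<open>K\<close> the only quotient with
      number \<open>f K\<close>, so there is exactly one successor.\<close>
    have "{q. \<exists>p\<in>{f K}. (p, x, q) \<in> \<Delta>} = {f {v. x # v \<in> K}}"
      using Cons.prems f unfolding \<Delta>_def by (auto dest: inj_onD)
    then show ?case using Cons.IH[OF R_deriv[OF Cons.prems(1), of x]] Cons.prems by simp
  qed simp
  have in_R: "{v. xs @ v \<in> L} \<in> R" for xs unfolding R_def by auto
  have "nfa_reach \<Delta> {f L} xs \<inter> F \<noteq> {} \<longleftrightarrow> xs \<in> L" if "xs \<in> lists A" for xs
    unfolding reach[OF \<open>L \<in> R\<close> that] F_def using in_R[of xs] f
    by (auto dest: inj_onD)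
  then have "L = {xs \<in> lists A. nfa_reach \<Delta> {f L} xs \<inter> F \<noteq> {}}"
    using assms(2) by auto
  moreover have "finite (f ` R)" "\<Delta> \<subseteq> f ` R \<times> A \<times> f ` R" "{f L} \<subseteq> f ` R" "F \<subseteq> f ` R"
    using \<open>finite R\<close> \<open>L \<in> R\<close> R_deriv unfolding \<Delta>_def F_def by auto
  ultimately show ?thesis unfolding fa_recognizable_def by blast
qed

subsection \<open>Padded words and runs\<close>

text \<open>The track of \<open>s\<close> in a word of length \<open>n\<close>. A string longer than
  \<open>n\<close> is cut off, which is why bounds on lengths accompany this function.\<close>

definition padded :: "nat \<Rightarrow> 'g list \<Rightarrow> 'g option list" where
  "padded n s = map (padded_nth s) [0..<n]"

lemma length_padded [simp]: "length (padded n s) = n"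
  by (simp add: padded_def)

lemma nth_padded [simp]: "i < n \<Longrightarrow> padded n s ! i = padded_nth s i"
  by (simp add: padded_def)

lemma padded_nth_ext:
  assumes "\<And>i. padded_nth s i = padded_nth t i" shows "s = t"
proof -
  have "(i < length s) = (i < length t)" for i
    using assms[of i] by (auto simp: padded_nth_def split: if_splits)
  then have "length s = length t" by (metis linorder_neqE_nat nat_less_le)
  then show ?thesis
    by (rule nth_equalityI) (use assms in \<open>force simp: padded_nth_def split: if_splits\<close>)
qed

lemma padded_inj:
  assumes "padded n s = padded n t" "length s \<le> n" "length t \<le> n" shows "s = t"
proof (rule padded_nth_ext)
  fix i show "padded_nth s i = padded_nth t i"
  proof (cases "i < n")
    case True then show ?thesis using assms(1) nth_padded by metis
  qed (use assms in \<open>simp add: padded_nth_def\<close>)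
qed

lemma padded_conv_append:
  "length s \<le> n \<Longrightarrow> padded n s = map Some s @ replicate (n - length s) None"
  by (rule nth_equalityI) (auto simp: padded_nth_def nth_append)

text \<open>Once \<open>None\<close> has been read, only \<open>None\<close> may follow; so every
  quotient is the language itself, \<open>lists {None}\<close> or empty.\<close>

lemma fin_quot_padded:
  "fin_quot {ys :: 'g option list. \<exists>s. length s \<le> length ys \<and> ys = padded (length ys) s}"
proof -
  have eq: "{ys :: 'g option list. \<exists>s. length s \<le> length ys \<and> ys = padded (length ys) s} =
      {map Some s @ replicate n None | s n. True}" (is "_ = ?P")
  proof (intro set_eqI iffI)
    fix ys :: "'g option list"
    assume "ys \<in> ?P"
    then obtain s n where "ys = map Some s @ replicate n None" by auto
    then show "ys \<in> {ys. \<exists>s. length s \<le> length ys \<and> ys = padded (length ys) s}"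
      by (auto simp: padded_conv_append intro!: exI[of _ s])
  qed (auto, metis padded_conv_append)
  have S: "{v. Some x # v \<in> ?P} = ?P" for x
  proof (intro set_eqI iffI)
    fix v assume "v \<in> {v. Some x # v \<in> ?P}"
    then obtain s n where "Some x # v = map Some s @ replicate n None" by auto
    then have "v = map Some (tl s) @ replicate n None" by (cases s; cases n) auto
    then show "v \<in> ?P" by blast
  next
    fix v assume "v \<in> ?P"
    then obtain s n where "v = map Some s @ replicate n None" by auto
    then have "Some x # v = map Some (x # s) @ replicate n None" by simp
    then show "v \<in> {v. Some x # v \<in> ?P}" by blast
  qed
  have N: "{v. None # v \<in> ?P} = lists {None}"
  proof (intro set_eqI iffI)
    fix v :: "'g option list" assume "v \<in> {v. None # v \<in> ?P}"
    then obtain s n where "None # v = map Some s @ replicate n None" by auto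
    then show "v \<in> lists {None}" by (cases s; cases n) (auto simp: lists_eq_set)
  next
    fix v :: "'g option list" assume "v \<in> lists {None}"
    then have "v = replicate (length v) None"
      by (metis in_listsD replicate_eqI singletonD)
    then have "None # v = map Some [] @ replicate (Suc (length v)) None" by simp
    then show "v \<in> {v. None # v \<in> ?P}" by blast
  qed
  show ?thesis unfolding eq
  proof (rule fin_quot_family[of "{?P, lists {None}, {}}"])
    fix K x assume "K \<in> {?P, lists {None}, {}}"
    then show "{v. x # v \<in> K} \<in> {?P, lists {None}, {}}"
    proof (elim insertE emptyE)
      assume "K = ?P" then show ?thesis using S N by (cases x) blast+
    next
      assume "K = lists {None}" then show ?thesis
        by (cases x) (auto simp: lists_eq_set)
    qed simp
  qed auto
qed

section \<open>Runs of decision diagrams as sets of reachable states\<close>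

fun steps :: "nat set \<Rightarrow> ('b layer \<times> 'b option) list \<Rightarrow> nat set" where
  "steps S [] = S"
| "steps S (x # xs) = steps {q. \<exists>p\<in>S. (p, snd x, q) \<in> ltrans (fst x)} xs"

lemma steps_iff:
  "q \<in> steps S ps \<longleftrightarrow> (\<exists>r. r 0 \<in> S \<and> r (length ps) = q \<and>
     (\<forall>i<length ps. (r i, snd (ps ! i), r (Suc i)) \<in> ltrans (fst (ps ! i))))"
proof (induction ps arbitrary: S)
  case Nil
  show ?case by (auto intro: exI[of _ "\<lambda>_. q"])
next
  case (Cons x ps)
  show ?case (is "?L \<longleftrightarrow> ?R")
  proof
    assume ?L
    then obtain r p where "p \<in> S" "(p, snd x, r 0) \<in> ltrans (fst x)" "r (length ps) = q"
      "\<forall>i<length ps. (r i, snd (ps ! i), r (Suc i)) \<in> ltrans (fst (ps ! i))"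
      using Cons.IH by auto
    then show ?R
      by (intro exI[of _ "\<lambda>i. case i of 0 \<Rightarrow> p | Suc i \<Rightarrow> r i"]) (auto simp: less_Suc_eq_0_disj)
  next
    assume ?R
    then obtain r where r: "r 0 \<in> S" "r (Suc (length ps)) = q"
      "\<forall>i<Suc (length ps). (r i, snd ((x # ps) ! i), r (Suc i)) \<in> ltrans (fst ((x # ps) ! i))"
      by auto
    have "(r 0, snd x, r (Suc 0)) \<in> ltrans (fst x)"
      "\<forall>i<length ps. (r (Suc i), snd (ps ! i), r (Suc (Suc i))) \<in> ltrans (fst (ps ! i))"
      using r(3) by (auto simp: All_less_Suc2)
    then show ?L using r(1,2) Cons.IH
      by (auto intro!: exI[of _ "\<lambda>i. r (Suc i)"])
  qed
qed

text \<open>This isolates the part of acceptance that concerns transitions; that the second track is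
  the padding of a nonempty string is imposed separately.\<close>

definition run_accepts :: "('b layer \<times> 'b option) list \<Rightarrow> bool" where
  "run_accepts ps \<longleftrightarrow>
     ps \<noteq> [] \<and> steps (linit (fst (hd ps))) ps \<inter> lfinal (fst (last ps)) \<noteq> {}"

text \<open>The sources \<open>p\<close> and targets \<open>q\<close> of the transitions merge into
  one sequence \<open>r\<close> of states, where \<open>r i\<close> is the state before layer
  \<open>i\<close> and \<open>r (Suc i)\<close> the state after it.\<close>

lemma odd_accepts_iff_run:
  "odd_accepts D s \<longleftrightarrow> s \<noteq> [] \<and> length s \<le> length D \<and> run_accepts (zip D (padded (length D) s))"
proof (cases "s \<noteq> [] \<and> length s \<le> length D")
  case True
  let ?n = "length D" and ?ps = "zip D (padded (length D) s)"
  have "D \<noteq> []" using True by auto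
  then have n: "?n > 0" "?ps \<noteq> []" by (simp_all add: zip_eq_Nil_iff flip: length_greater_0_conv)
  have hd: "fst (hd ?ps) = D ! 0" "fst (last ?ps) = D ! (?n - 1)"
    using n by (simp_all add: hd_conv_nth last_conv_nth)
  have "(\<exists>p q. (\<forall>i<?n. (p i, padded_nth s i, q i) \<in> ltrans (D ! i)) \<and>
        (\<forall>i. Suc i < ?n \<longrightarrow> p (Suc i) = q i) \<and>
        p 0 \<in> linit (D ! 0) \<and> q (?n - 1) \<in> lfinal (D ! (?n - 1))) \<longleftrightarrow>
      (\<exists>r. r 0 \<in> linit (D ! 0) \<and> r ?n \<in> lfinal (D ! (?n - 1)) \<and>
        (\<forall>i<?n. (r i, padded_nth s i, r (Suc i)) \<in> ltrans (D ! i)))" (is "?L \<longleftrightarrow> ?R")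
  proof
    assume ?L
    then obtain p q where pq: "\<forall>i<?n. (p i, padded_nth s i, q i) \<in> ltrans (D ! i)"
      "\<forall>i. Suc i < ?n \<longrightarrow> p (Suc i) = q i" "p 0 \<in> linit (D ! 0)"
      "q (?n - 1) \<in> lfinal (D ! (?n - 1))" by auto
    define r where "r i = (case i of 0 \<Rightarrow> p 0 | Suc i \<Rightarrow> q i)" for i
    have "r i = p i" if "i < ?n" for i using pq(2) that by (cases i) (auto simp: r_def)
    moreover have "r (Suc i) = q i" for i by (simp add: r_def)
    moreover have "r ?n = q (?n - 1)" using n by (cases ?n) (auto simp: r_def)
    ultimately have "r 0 \<in> linit (D ! 0) \<and> r ?n \<in> lfinal (D ! (?n - 1)) \<and>
        (\<forall>i<?n. (r i, padded_nth s i, r (Suc i)) \<in> ltrans (D ! i))"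
      using pq n by simp
    then show ?R by blast
  next
    assume ?R
    then obtain r where "r 0 \<in> linit (D ! 0) \<and> r ?n \<in> lfinal (D ! (?n - 1)) \<and>
        (\<forall>i<?n. (r i, padded_nth s i, r (Suc i)) \<in> ltrans (D ! i))" by auto
    then show ?L using n by (intro exI[of _ r] exI[of _ "\<lambda>i. r (Suc i)"]) auto
  qed
  also have "?R \<longleftrightarrow> run_accepts ?ps"
    unfolding run_accepts_def hd using n by (auto simp: steps_iff disjoint_iff)
  finally show ?thesis using True unfolding odd_accepts_def by blast
next
  case False
  then have "\<not> odd_accepts D s" unfolding odd_accepts_def by blast
  with False show ?thesis by blast
qed

text \<open>Bounding the targets confines the reachable states after each letter to
  \<open>{..<w}\<close>. No alphabet enters, so the same notion serves \<open>D0\<close> and the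
  diagrams of all arities.\<close>

definition bounded_layers :: "nat \<Rightarrow> 'b layer set" where
  "bounded_layers w = {B. ltrans B \<subseteq> UNIV \<times> UNIV \<times> {..<w}}"

lemma layers_bounded: "layers \<Sigma> w \<subseteq> bounded_layers w"
proof
  fix B assume "B \<in> layers \<Sigma> w"
  then have "ltrans B \<subseteq> lleft B \<times> pad_alphabet \<Sigma> \<times> lright B" "lright B \<subseteq> {0..<w}"
    by (simp_all add: layers_def)
  then show "B \<in> bounded_layers w" unfolding bounded_layers_def by auto
qed

text \<open>After a nonempty prefix of bounded layers, the accepted continuations depend only on the
  set of reachable states, a subset of \<open>{..<w}\<close>, and on one bit.\<close>

lemma fin_quot_run: "fin_quot {ps \<in> lists (bounded_layers w \<times> UNIV). run_accepts ps}"
proof -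
  let ?W = "bounded_layers w \<times> UNIV :: ('a layer \<times> 'a option) set"
  let ?R = "{ps \<in> lists ?W. run_accepts ps}"
  \<comment> \<open>The bit \<open>b\<close> tells whether the prefix itself is accepted: the final
    states are those of the last layer, which lies in the prefix when \<open>ps\<close> is
    empty.\<close>
  define K where "K S b = {ps \<in> lists ?W.
    if ps = [] then b else steps S ps \<inter> lfinal (fst (last ps)) \<noteq> {}}" for S b
  define nxt where "nxt S x = {q. \<exists>p\<in>S. (p, snd x, q) \<in> ltrans (fst x)}"
    for S and x :: "'a layer \<times> 'a option"
  let ?F = "insert {} (insert ?R ((\<lambda>(S, b). K S b) ` (Pow {..<w} \<times> UNIV)))"
  have nxt: "nxt S x \<subseteq> {..<w}" if "x \<in> ?W" for S x
    using that by (auto simp: nxt_def bounded_layers_def)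
  have K: "{v. x # v \<in> K S b} = K (nxt S x) (nxt S x \<inter> lfinal (fst x) \<noteq> {})" if "x \<in> ?W" for S b x
    using that by (auto simp: K_def nxt_def split: if_splits)
  have R: "{v. x # v \<in> ?R} = K (nxt (linit (fst x)) x) (nxt (linit (fst x)) x \<inter> lfinal (fst x) \<noteq> {})"
    if "x \<in> ?W" for x
    using that by (auto simp: K_def nxt_def run_accepts_def split: if_splits)
  show ?thesis
  proof (rule fin_quot_family[of ?F])
    fix M x assume M: "M \<in> ?F"
    show "{v. x # v \<in> M} \<in> ?F"
    proof (cases "x \<in> ?W")
      case False
      then have "{v. x # v \<in> M} = {}" using M by (auto simp: K_def)
      then show ?thesis by simp
    next
      case True
      have in_F: "K (nxt S x) b \<in> ?F" for S b
        using nxt[OF True, of S] by (intro insertI2 image_eqI[of _ _ "(nxt S x, b)"]) auto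
      from M consider "M = {}" | "M = ?R" | S b where "M = K S b" by auto
      then show ?thesis
      proof cases
        case 2 show ?thesis unfolding 2 R[OF True] by (rule in_F)
      next
        case 3 show ?thesis unfolding 3 K[OF True] by (rule in_F)
      qed simp
    qed
  qed auto
qed

definition accepted_words :: "nat \<Rightarrow> ('b layer \<times> 'b option) list set" where
  "accepted_words w = {ps \<in> lists (bounded_layers w \<times> UNIV).
     \<exists>u. odd_accepts (map fst ps) u \<and> map snd ps = padded (length ps) u}"

text \<open>The condition splits into three: the run accepts, the second track is a padded string,
  and this track is not all \<open>None\<close>. The last one expresses that the string is
  nonempty.\<close>

lemma fin_quot_accepted_words: "fin_quot (accepted_words w :: ('b layer \<times> 'b option) list set)"
proof -
  have "(accepted_words w :: ('b layer \<times> 'b option) list set) = {ps \<in> lists (bounded_layers w \<times> UNIV). run_accepts ps} \<inter>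
      {ps. map snd ps \<in> {ys. \<exists>s. length s \<le> length ys \<and> ys = padded (length ys) s}} \<inter>
      - {ps. map snd ps \<in> lists {None}}" (is "?A = ?B")
  proof -
    have "ps \<in> ?A \<longleftrightarrow> ps \<in> ?B" for ps
    proof -
      have ne: "u \<noteq> [] \<longleftrightarrow> padded n u \<notin> lists {None}" if "length u \<le> n" for u :: "'b list" and n
        using that by (cases u) (auto simp: padded_conv_append lists_eq_set)
      have eq: "odd_accepts (map fst ps) u \<longleftrightarrow> run_accepts ps \<and> length u \<le> length ps \<and>
          map snd ps \<notin> lists {None}" if "map snd ps = padded (length ps) u" for u
      proof -
        have z: "zip (map fst ps) (padded (length ps) u) = ps" using that by (metis zip_map_fst_snd)
        show ?thesis unfolding odd_accepts_iff_run length_map z that using ne[of u "length ps"] by blast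
      qed
      show ?thesis
      proof
        assume "ps \<in> ?A"
        then obtain u where "ps \<in> lists (bounded_layers w \<times> UNIV)"
          "odd_accepts (map fst ps) u" and u: "map snd ps = padded (length ps) u"
          unfolding accepted_words_def by blast
        then show "ps \<in> ?B" using eq[OF u] by (auto simp del: in_lists_conv_set)
      next
        assume B: "ps \<in> ?B"
        then obtain s where s: "length s \<le> length ps" "map snd ps = padded (length ps) s" by auto
        then show "ps \<in> ?A" using eq[OF s(2)] B unfolding accepted_words_def by blast
      qed
    qed
    then show ?thesis by blast
  qed
  then show ?thesis
    by (simp only:) (intro fin_quot_inter fin_quot_run fin_quot_compl
        fin_quot_vimage[OF fin_quot_padded] fin_quot_vimage[OF fin_quot_lists])
qed

text \<open>A string no longer than the diagram is determined by its track, so the witness in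
  \<open>accepted_words\<close> can only be \<open>s\<close>.\<close>

lemma accepted_words_iff:
  assumes "set D \<subseteq> bounded_layers w" "length s \<le> length D"
  shows "zip D (padded (length D) s) \<in> accepted_words w \<longleftrightarrow> odd_accepts D s"
proof -
  have "zip D (padded (length D) s) \<in> lists (bounded_layers w \<times> UNIV)"
    using assms(1) by (auto dest: set_zip_leftD)
  moreover have "u = s" if "odd_accepts D u" "padded (length D) s = padded (length D) u" for u
    using that assms(2) padded_inj[of "length D" u s] by (simp add: odd_accepts_def)
  ultimately show ?thesis unfolding accepted_words_def by auto
qed

subsection \<open>Ordered decision diagrams\<close>

text \<open>Meant for \<open>liflag\<close>: after a marked first letter only unmarked letters may
  follow.\<close>

lemma fin_quot_marks_first: "fin_quot {D. \<forall>i<length D. P (D ! i) \<longleftrightarrow> i = 0}" (is "fin_quot ?L")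
proof (rule fin_quot_family[of "{?L, lists {d. \<not> P d}, {}}"])
  fix K x assume "K \<in> {?L, lists {d. \<not> P d}, {}}"
  moreover have "{v. x # v \<in> ?L} = (if P x then lists {d. \<not> P d} else {})"
  proof -
    have "v \<in> lists {d. \<not> P d} \<longleftrightarrow> (\<forall>i<length v. \<not> P (v ! i))" for v
      by (simp add: in_lists_conv_set all_set_conv_all_nth)
    then show ?thesis by (auto simp: All_less_Suc2)
  qed
  moreover have "{v. x # v \<in> lists {d. \<not> P d}} = (if P x then {} else lists {d. \<not> P d})"
    by auto
  ultimately show "{v. x # v \<in> K} \<in> {?L, lists {d. \<not> P d}, {}}"
    by (elim insertE emptyE) simp_all
qed auto

text \<open>Meant for \<open>lfflag\<close>: an unmarked letter demands a nonempty continuation,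
  hence \<open>?L - {[]}\<close>, and a marked one must be the last, hence
  \<open>{[]}\<close>.\<close>

lemma fin_quot_marks_last:
  "fin_quot {D. \<forall>i<length D. P (D ! i) \<longleftrightarrow> i = length D - 1}" (is "fin_quot ?L")
proof (rule fin_quot_family[of "{?L, ?L - {[]}, {[]}, {}}"])
  fix K x assume "K \<in> {?L, ?L - {[]}, {[]}, {}}"
  moreover have "{v. x # v \<in> ?L} = (if P x then {[]} else ?L - {[]})"
  proof -
    have "x # v \<in> ?L \<longleftrightarrow> v \<in> (if P x then {[]} else ?L - {[]})" for v
      by (cases v) (auto simp: All_less_Suc2)
    then show ?thesis by blast
  qed
  ultimately show "{v. x # v \<in> K} \<in> {?L, ?L - {[]}, {[]}, {}}"
    by (elim insertE emptyE) simp_all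
qed auto

text \<open>Matching adjacent layers requires remembering only \<open>lright\<close> of the last
  letter, a subset of \<open>{0..<w}\<close>; \<open>K S\<close> collects the continuations when
  this set is \<open>S\<close>.\<close>

lemma fin_quot_odd_chain:
  "fin_quot {D \<in> lists (layers \<Sigma> w). \<forall>i. Suc i < length D \<longrightarrow> lleft (D ! Suc i) = lright (D ! i)}"
  (is "fin_quot ?L")
proof -
  define K where "K S = {D \<in> ?L. D \<noteq> [] \<longrightarrow> lleft (hd D) = S}" for S
  let ?F = "{?L, {}} \<union> K ` Pow {0..<w}"
  have L: "{v. x # v \<in> ?L} = (if x \<in> layers \<Sigma> w then K (lright x) else {})" for x
  proof -
    have "x # v \<in> ?L \<longleftrightarrow> v \<in> (if x \<in> layers \<Sigma> w then K (lright x) else {})" for v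
    proof (cases v)
      case (Cons y v')
      have "(\<forall>i. Suc i < length (x # v) \<longrightarrow> lleft ((x # v) ! Suc i) = lright ((x # v) ! i)) \<longleftrightarrow>
          lleft y = lright x \<and> (\<forall>i. Suc i < length v \<longrightarrow> lleft (v ! Suc i) = lright (v ! i))"
        unfolding Cons by (auto simp: all_conj_distrib nth_Cons split: nat.splits)
      then show ?thesis unfolding K_def using Cons by auto
    qed (auto simp: K_def)
    then show ?thesis by blast
  qed
  have K: "{v. x # v \<in> K S} = (if lleft x = S then {v. x # v \<in> ?L} else {})" for x S
    by (auto simp: K_def)
  show ?thesis
  proof (rule fin_quot_family[of ?F])
    fix M x assume "M \<in> ?F"
    then consider "M = {}" | "M = ?L" | S where "M = K S" by blast
    moreover have "{v. x # v \<in> ?L} \<in> ?F" unfolding L by (auto simp: layers_def)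
    ultimately show "{v. x # v \<in> M} \<in> ?F"
    proof cases
      case 3
      show ?thesis unfolding 3 K using \<open>{v. x # v \<in> ?L} \<in> ?F\<close> by simp
    qed simp_all
  qed auto
qed

lemma fin_quot_odds: "fin_quot {D. D \<in> odds \<Sigma> w (length D)}"
proof -
  \<comment> \<open>The only member of \<open>lists {}\<close> is the empty word, so its complement
    expresses that the length is at least 1.\<close>
  have "{D. D \<in> odds \<Sigma> w (length D)} =
    {D \<in> lists (layers \<Sigma> w). \<forall>i. Suc i < length D \<longrightarrow> lleft (D ! Suc i) = lright (D ! i)} \<inter>
    {D. \<forall>i<length D. liflag (D ! i) \<longleftrightarrow> i = 0} \<inter>
    {D. \<forall>i<length D. lfflag (D ! i) \<longleftrightarrow> i = length D - 1} \<inter> - lists {}"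
    by (auto simp: odds_def Suc_le_eq)
  then show ?thesis
    by (simp only:) (intro fin_quot_inter fin_quot_compl fin_quot_lists fin_quot_odd_chain
        fin_quot_marks_first fin_quot_marks_last)
qed

subsection \<open>Tensor products\<close>

text \<open>Padding occurs on two levels: a column consisting of \<open>None\<close> only lies
  beyond the end of the tensor product and becomes the outer \<open>None\<close>; any other column
  is a letter of it.\<close>

definition tuple_symbol :: "'a option list \<Rightarrow> 'a option list option" where
  "tuple_symbol xs = (if set xs \<subseteq> {None} then None else Some xs)"

lemma length_tensor: "length (tensor us) = Max (length ` set us)"
  by (simp add: tensor_def)

lemma padded_nth_eq_None_iff: "padded_nth u j = None \<longleftrightarrow> length u \<le> j"
  by (auto simp: padded_nth_def)

text \<open>Position \<open>j\<close> lies beyond the tensor product exactly when it lies beyond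
  every component, that is, when the column is all \<open>None\<close>.\<close>

lemma padded_nth_tensor:
  assumes "us \<noteq> []"
  shows "padded_nth (tensor us) j = tuple_symbol (map (\<lambda>u. padded_nth u j) us)"
proof -
  have "j < Max (length ` set us) \<longleftrightarrow> \<not> (\<forall>u\<in>set us. length u \<le> j)"
    using assms by (subst Max_gr_iff) (auto simp: not_le)
  moreover have "set (map (\<lambda>u. padded_nth u j) us) \<subseteq> {None} \<longleftrightarrow> (\<forall>u\<in>set us. length u \<le> j)"
    by (simp add: image_subset_iff padded_nth_eq_None_iff)
  moreover have "padded_nth (tensor us) j =
      (if j < Max (length ` set us) then Some (map (\<lambda>u. padded_nth u j) us) else None)"
    unfolding padded_nth_def[of "tensor us"] length_tensor by (simp add: tensor_def)
  ultimately show ?thesis unfolding tuple_symbol_def by simp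
qed

lemma length_tensor_le:
  assumes "us \<noteq> []" "\<forall>u\<in>set us. length u \<le> n" shows "length (tensor us) \<le> n"
  using assms by (simp add: length_tensor)

text \<open>Each column can be read back from its \<open>tuple_symbol\<close>: \<open>Some\<close>
  carries it, and \<open>None\<close> stands for the all-padding column, whose width is fixed by the
  equal lengths.\<close>

lemma tensor_inj:
  assumes "tensor us = tensor vs" "length us = length vs" "us \<noteq> []"
  shows "us = vs"
proof (rule nth_equalityI[OF assms(2)])
  fix i assume i: "i < length us"
  show "us ! i = vs ! i"
  proof (rule padded_nth_ext)
    fix j
    have "tuple_symbol (map (\<lambda>u. padded_nth u j) us) = tuple_symbol (map (\<lambda>u. padded_nth u j) vs)"
      using assms padded_nth_tensor by (metis length_0_conv)
    then show "padded_nth (us ! i) j = padded_nth (vs ! i) j"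
    proof (cases "set (map (\<lambda>u. padded_nth u j) us) \<subseteq> {None}")
      case True
      then have "set (map (\<lambda>u. padded_nth u j) vs) \<subseteq> {None}"
        using \<open>tuple_symbol _ = _\<close> by (auto simp: tuple_symbol_def split: if_splits)
      then show ?thesis using True i assms(2) by (simp add: image_subset_iff)
    next
      case False
      then have "map (\<lambda>u. padded_nth u j) us = map (\<lambda>u. padded_nth u j) vs"
        using \<open>tuple_symbol _ = _\<close> by (auto simp: tuple_symbol_def split: if_splits)
      then show ?thesis using i assms(2) by (metis nth_map)
    qed
  qed
qed

lemma listset_iff:
  "xs \<in> listset As \<longleftrightarrow> length xs = length As \<and> (\<forall>i<length As. xs ! i \<in> As ! i)"
proof (induction As arbitrary: xs)
  case (Cons A As)
  show ?case by (cases xs) (auto simp: set_Cons_def Cons.IH All_less_Suc2)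
qed simp

lemma listset_replicate: "xs \<in> listset (replicate n A) \<longleftrightarrow> length xs = n \<and> set xs \<subseteq> A"
  by (auto simp: listset_iff in_set_conv_nth subset_iff)

lemma tensor_in_lists:
  assumes "us \<in> listset (map plus_strings \<Gamma>s)"
  shows "tensor us \<in> lists (tensor_alphabet (map pad_alphabet \<Gamma>s))"
  using assms
  by (fastforce simp: listset_iff tensor_def tensor_alphabet_def padded_nth_def pad_alphabet_def
      plus_strings_def)

text \<open>Inverts \<open>tuple_symbol\<close> componentwise; the outer \<open>None\<close> is read
  as a column of \<open>None\<close>.\<close>

definition symbol_component :: "nat \<Rightarrow> 'a option list option \<Rightarrow> 'a option" where
  "symbol_component i c = (case c of None \<Rightarrow> None | Some l \<Rightarrow> l ! i)"

lemma symbol_component_tuple_symbol: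
  "i < length xs \<Longrightarrow> symbol_component i (tuple_symbol xs) = xs ! i"
  by (auto simp: symbol_component_def tuple_symbol_def) (metis nth_mem singletonD subset_iff)

text \<open>Membership becomes a condition on tracks, accessible to letter maps. The second conjunct
  excludes malformed letters, such as \<open>Some\<close> of an all-padding column, which
  \<open>symbol_component\<close> cannot tell from the outer \<open>None\<close>.\<close>

lemma in_tensor_power_language_iff:
  assumes "a \<ge> 1" "length s \<le> length D"
  shows "s \<in> tensor_power_language (odd_language D) a \<longleftrightarrow>
    (\<forall>i<a. \<exists>u. odd_accepts D u \<and>
       map (symbol_component i) (padded (length D) s) = padded (length D) u) \<and>
    (\<forall>c\<in>set (padded (length D) s). c = None \<or> (\<exists>l. c = Some l \<and> length l = a \<and> \<not> set l \<subseteq> {None}))"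
    (is "?L \<longleftrightarrow> ?R")
proof
  assume ?L
  then obtain us where us: "length us = a" "\<forall>u\<in>set us. odd_accepts D u" "s = tensor us"
    unfolding tensor_power_language_def tensor_language_def odd_language_def
    by (auto simp: listset_replicate subset_iff)
  have ne: "us \<noteq> []" using assms us by auto
  have p: "padded (length D) s = map (\<lambda>j. tuple_symbol (map (\<lambda>u. padded_nth u j) us)) [0..<length D]"
    unfolding padded_def us(3) padded_nth_tensor[OF ne] by simp
  have "map (symbol_component i) (padded (length D) s) = padded (length D) (us ! i)" if "i < a" for i
    unfolding p using that us(1) by (auto simp: padded_def symbol_component_tuple_symbol)
  moreover have "\<forall>c\<in>set (padded (length D) s).
      c = None \<or> (\<exists>l. c = Some l \<and> length l = a \<and> \<not> set l \<subseteq> {None})"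
    unfolding p using us(1) by (auto simp: tuple_symbol_def image_subset_iff)
  ultimately show ?R using us by (metis nth_mem)
next
  assume R: ?R
  then obtain u where u: "\<And>i. i < a \<Longrightarrow> odd_accepts D (u i)"
      "\<And>i. i < a \<Longrightarrow> map (symbol_component i) (padded (length D) s) = padded (length D) (u i)"
    by metis
  define us where "us = map u [0..<a]"
  have us: "length us = a" "us \<noteq> []" "\<forall>v\<in>set us. odd_accepts D v"
    using assms u by (auto simp: us_def)
  have "s = tensor us"
  proof (rule padded_inj[OF _ assms(2)])
    show "length (tensor us) \<le> length D"
      using us by (intro length_tensor_le) (auto simp: odd_accepts_def)
    show "padded (length D) s = padded (length D) (tensor us)"
    proof (rule nth_equalityI)
      fix j assume "j < length (padded (length D) s)"
      then have j: "j < length D" by simp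
      have c: "symbol_component i (padded_nth s j) = padded_nth (u i) j" if "i < a" for i
        using arg_cong[OF u(2)[OF that], of "\<lambda>xs. xs ! j"] j by simp
      have "padded_nth s j \<in> set (padded (length D) s)"
        using j by (auto simp: padded_def)
      from bspec[OF conjunct2[OF R] this]
      consider "padded_nth s j = None" |
        l where "padded_nth s j = Some l" "length l = a" "\<not> set l \<subseteq> {None}"
        by auto
      then have "padded_nth s j = tuple_symbol (map (\<lambda>v. padded_nth v j) us)"
      proof cases
        case 1
        then show ?thesis using c by (auto simp: us_def tuple_symbol_def symbol_component_def)
      next
        case 2
        have "map (\<lambda>v. padded_nth v j) us = l"
          using c 2 by (intro nth_equalityI) (auto simp: us_def symbol_component_def)
        then show ?thesis using 2 by (simp add: tuple_symbol_def)
      qed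
      then show "padded (length D) s ! j = padded (length D) (tensor us) ! j"
        using j by (simp add: padded_nth_tensor[OF us(2)])
    qed simp
  qed
  moreover have "us \<in> listset (replicate a (odd_language D))"
    using us by (auto simp: listset_replicate odd_language_def)
  ultimately show ?L by (simp add: tensor_power_language_def tensor_language_def)
qed

text \<open>
  The words \<open>zs\<close> in \<open>Z\<close> below pair \<open>bs\<close> with a padded string that witnesses the failure of the
  inclusion; erasing the witness is a direct image under a letter map.
\<close>

lemma fin_quot_language_subset:
  assumes "a \<ge> 1" "g0 ` G \<subseteq> bounded_layers w" "g ` G \<subseteq> bounded_layers w"
  shows "fin_quot {bs \<in> lists G. odd_language (map g bs) \<subseteq>
    tensor_power_language (odd_language (map g0 bs)) a}"
proof -
  define Z where "Z = {zs. map (\<lambda>(b, c). (g b, c)) zs \<in> accepted_words w} \<inter>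
    - ((\<Inter>i\<in>{..<a}. {zs. map (\<lambda>(b, c). (g0 b, symbol_component i c)) zs \<in> accepted_words w}) \<inter>
       {zs. map snd zs \<in> lists {c. c = None \<or> (\<exists>l. c = Some l \<and> length l = a \<and> \<not> set l \<subseteq> {None})}})"
  have "fin_quot Z" unfolding Z_def
    by (intro fin_quot_inter fin_quot_compl fin_quot_INT fin_quot_vimage fin_quot_accepted_words
        fin_quot_lists finite_lessThan)
  have *: "bs \<in> map fst ` Z \<longleftrightarrow>
      \<not> odd_language (map g bs) \<subseteq> tensor_power_language (odd_language (map g0 bs)) a"
    if bs: "bs \<in> lists G" for bs
  proof -
    let ?n = "length bs"
    have acc: "map (\<lambda>(b, c). (h b, f c)) (zip bs (padded ?n s)) \<in> accepted_words w \<longleftrightarrow>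
        (\<exists>u. odd_accepts (map h bs) u \<and> map f (padded ?n s) = padded ?n u)"
      if "h ` G \<subseteq> bounded_layers w" for h s and f :: "'c option \<Rightarrow> 'd option"
    proof -
      have "map fst (map (\<lambda>(b, c). (h b, f c)) (zip bs (padded ?n s))) = map h bs"
        "map snd (map (\<lambda>(b, c). (h b, f c)) (zip bs (padded ?n s))) = map f (padded ?n s)"
        by (auto intro: nth_equalityI)
      moreover have "map (\<lambda>(b, c). (h b, f c)) (zip bs (padded ?n s)) \<in> lists (bounded_layers w \<times> UNIV)"
        using bs that by (auto dest!: set_zip_leftD simp: image_subset_iff)
      ultimately show ?thesis unfolding accepted_words_def by (simp del: map_map)
    qed
    have in_Z: "zip bs (padded ?n s) \<in> Z \<longleftrightarrow>
        odd_accepts (map g bs) s \<and> s \<notin> tensor_power_language (odd_language (map g0 bs)) a"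
      if "length s \<le> ?n" for s
    proof -
      have "map (\<lambda>(b, c). (g b, c)) (zip bs (padded ?n s)) = zip (map g bs) (padded (length (map g bs)) s)"
        by (simp add: zip_map1)
      then have 1: "map (\<lambda>(b, c). (g b, c)) (zip bs (padded ?n s)) \<in> accepted_words w \<longleftrightarrow>
          odd_accepts (map g bs) s"
        using accepted_words_iff[of "map g bs" w s] bs assms(3) that by fastforce
      have 2: "map snd (zip bs (padded ?n s)) = padded ?n s" by simp
      note T = in_tensor_power_language_iff[OF assms(1), of s "map g0 bs", unfolded length_map, OF that]
      show ?thesis
        unfolding Z_def Int_iff Compl_iff mem_Collect_eq INT_iff 1 2 T acc[OF assms(2)] in_lists_conv_set
        by (simp add: Bex_def)
    qed
    show ?thesis
    proof
      assume "bs \<in> map fst ` Z"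
      then obtain zs where zs: "zs \<in> Z" "bs = map fst zs" by auto
      \<comment> \<open>Membership in \<open>accepted_words\<close> forces the second track, so far
        arbitrary, to be the padding of a string \<open>s\<close> that fits the length.\<close>
      then have "map (\<lambda>(b, c). (g b, c)) zs \<in> accepted_words w" by (auto simp: Z_def)
      then obtain s where s: "map snd zs = padded ?n s" "length s \<le> ?n"
        using zs(2) by (auto simp: accepted_words_def odd_accepts_def case_prod_unfold comp_def)
      then have "zs = zip bs (padded ?n s)" using zs(2) by (metis zip_map_fst_snd)
      then show "\<not> odd_language (map g bs) \<subseteq> tensor_power_language (odd_language (map g0 bs)) a"
        using in_Z[OF s(2)] zs(1) by (auto simp: odd_language_def)
    next
      assume "\<not> odd_language (map g bs) \<subseteq> tensor_power_language (odd_language (map g0 bs)) a"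
      then obtain s where s: "odd_accepts (map g bs) s"
          "s \<notin> tensor_power_language (odd_language (map g0 bs)) a"
        by (auto simp: odd_language_def)
      then have "length s \<le> ?n" by (simp add: odd_accepts_def)
      with s in_Z have "zip bs (padded ?n s) \<in> Z" by blast
      moreover have "map fst (zip bs (padded ?n s)) = bs" by simp
      ultimately show "bs \<in> map fst ` Z" by (metis imageI)
    qed
  qed
  have "{bs \<in> lists G. odd_language (map g bs) \<subseteq> tensor_power_language (odd_language (map g0 bs)) a} =
      lists G \<inter> - (map fst ` Z)"
    using * by blast
  then show ?thesis
    by (simp only:) (intro fin_quot_inter fin_quot_compl fin_quot_lists fin_quot_image \<open>fin_quot Z\<close>)
qed

subsection \<open>First-order definable languages\<close>

text \<open>Each letter carries the column of all variables at once, as a function, so quantifiers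
  leave the type of words unchanged.\<close>

definition encode :: "'b list \<Rightarrow> (nat \<Rightarrow> 'a list) \<Rightarrow> ('b \<times> (nat \<Rightarrow> 'a option)) list" where
  "encode bs v = map (\<lambda>j. (bs ! j, \<lambda>x. padded_nth (v x) j)) [0..<length bs]"

text \<open>Membership in \<open>L\<close> is prescribed only on encodings over \<open>G\<close> of
  valuations that fit the length. On other words \<open>L\<close> is free, so complementing
  \<open>L\<close> directly handles negation.\<close>

definition recog :: "'b set \<Rightarrow> ('b list \<Rightarrow> (nat \<Rightarrow> 'a list) \<Rightarrow> bool) \<Rightarrow> bool" where
  "recog G P \<longleftrightarrow> (\<exists>L. fin_quot L \<and>
     (\<forall>bs\<in>lists G. \<forall>v. (\<forall>x. length (v x) \<le> length bs) \<longrightarrow> (encode bs v \<in> L \<longleftrightarrow> P bs v)))"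

lemma recogI:
  assumes "fin_quot L"
    "\<And>bs v. bs \<in> lists G \<Longrightarrow> (\<And>x. length (v x) \<le> length bs) \<Longrightarrow> encode bs v \<in> L \<longleftrightarrow> P bs v"
  shows "recog G P"
  unfolding recog_def using assms by blast

lemma recogE:
  assumes "recog G P"
  obtains L where "fin_quot L"
    "\<And>bs v. bs \<in> lists G \<Longrightarrow> (\<And>x. length (v x) \<le> length bs) \<Longrightarrow> encode bs v \<in> L \<longleftrightarrow> P bs v"
  using assms unfolding recog_def by blast

lemma recog_not:
  assumes "recog G P" shows "recog G (\<lambda>bs v. \<not> P bs v)"
  using assms by (elim recogE) (rule recogI[OF fin_quot_compl], auto)

lemma recog_conj:
  assumes "recog G P" "recog G Q" shows "recog G (\<lambda>bs v. P bs v \<and> Q bs v)"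
proof -
  obtain L M where L: "fin_quot L" and M: "fin_quot M" and LM: "\<And>bs v. bs \<in> lists G \<Longrightarrow>
      (\<And>x. length (v x) \<le> length bs) \<Longrightarrow>
      (encode bs v \<in> L \<longleftrightarrow> P bs v) \<and> (encode bs v \<in> M \<longleftrightarrow> Q bs v)"
    using assms unfolding recog_def by metis
  show ?thesis
    by (rule recogI[OF fin_quot_inter[OF L M]]) (simp add: LM)
qed

lemma recog_cong:
  assumes "recog G P" "\<And>bs v. bs \<in> lists G \<Longrightarrow> P bs v \<longleftrightarrow> Q bs v"
  shows "recog G Q"
  using assms unfolding recog_def by simp

lemma recog_disj:
  assumes "recog G P" "recog G Q" shows "recog G (\<lambda>bs v. P bs v \<or> Q bs v)"
  using recog_not[OF recog_conj[OF assms[THEN recog_not]]] by simp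

lemma recog_pointwise:
  "(\<And>bs v. (\<And>x. length (v x) \<le> length bs) \<Longrightarrow>
      P bs v \<longleftrightarrow> (\<forall>j<length bs. Q (\<lambda>x. padded_nth (v x) j))) \<Longrightarrow> recog G P"
  by (rule recogI[OF fin_quot_lists[of "{z. Q (snd z)}"]]) (auto simp: encode_def in_lists_conv_set)

lemma recog_eq: "recog (G :: 'b set) (\<lambda>bs (v :: nat \<Rightarrow> 'a list). v x = v y)"
proof (rule recog_pointwise[where Q = "\<lambda>f. f x = f y"])
  fix bs :: "'b list" and v :: "nat \<Rightarrow> 'a list" assume le: "\<And>x. length (v x) \<le> length bs"
  show "v x = v y \<longleftrightarrow> (\<forall>j<length bs. padded_nth (v x) j = padded_nth (v y) j)"
  proof
    assume "\<forall>j<length bs. padded_nth (v x) j = padded_nth (v y) j"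
    then have "padded (length bs) (v x) = padded (length bs) (v y)"
      by (auto intro: nth_equalityI)
    then show "v x = v y" using padded_inj le by metis
  qed simp
qed

lemma recog_Nil: "recog (G :: 'b set) (\<lambda>bs (v :: nat \<Rightarrow> 'a list). v x = [])"
proof (rule recog_pointwise[where Q = "\<lambda>f. f x = None"])
  fix bs :: "'b list" and v :: "nat \<Rightarrow> 'a list" assume "\<And>x. length (v x) \<le> length bs"
  from this[of x] show "v x = [] \<longleftrightarrow> (\<forall>j<length bs. padded_nth (v x) j = None)"
    unfolding padded_nth_eq_None_iff
    by (cases bs) (simp_all add: All_less_Suc2, force)
qed

lemma recog_Nil_notin: "recog G (\<lambda>bs v. [] \<notin> v ` set xs)"
proof (induction xs)
  case Nil
  show ?case by (rule recogI[OF fin_quot_UNIV]) simp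
next
  case (Cons x xs)
  show ?case using recog_conj[OF recog_not[OF recog_Nil[of G x]] Cons.IH]
    by (rule recog_cong) auto
qed

text \<open>Sending a column \<open>f\<close> to \<open>tuple_symbol (map f xs)\<close> turns the
  variable tracks into the track of the tensor product, so the atom is an inverse image of
  \<open>accepted_words\<close>, up to excluding empty strings.\<close>

lemma recog_relation:
  assumes "g ` G \<subseteq> bounded_layers w" "xs \<noteq> []"
  shows "recog G (\<lambda>bs v. map v xs \<in> relation_of (length xs) (odd_language (map g bs)))"
proof -
  have "recog G (\<lambda>bs v. odd_accepts (map g bs) (tensor (map v xs)))"
  proof (rule recogI[OF fin_quot_vimage[OF fin_quot_accepted_words[of w]]])
    fix bs and v :: "nat \<Rightarrow> 'a list"
    assume bs: "bs \<in> lists G" and le: "\<And>x. length (v x) \<le> length bs"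
    have "map (\<lambda>(b, f). (g b, tuple_symbol (map f xs))) (encode bs v) =
        zip (map g bs) (padded (length (map g bs)) (tensor (map v xs)))"
      using assms(2)
      by (intro nth_equalityI) (auto simp: encode_def padded_nth_tensor comp_def)
    moreover have "length (tensor (map v xs)) \<le> length (map g bs)"
      using assms(2) le by (intro length_tensor_le) auto
    moreover have "set (map g bs) \<subseteq> bounded_layers w" using bs assms(1) by fastforce
    ultimately show "encode bs v \<in>
          {zs. map (\<lambda>(b, f). (g b, tuple_symbol (map f xs))) zs \<in> accepted_words w} \<longleftrightarrow>
        odd_accepts (map g bs) (tensor (map v xs))"
      using accepted_words_iff[of "map g bs" w "tensor (map v xs)"] by simp
  qed
  from recog_conj[OF recog_Nil_notin[of G xs] this] show ?thesis
    by (rule recog_cong) (auto simp: relation_of_def odd_language_def)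
qed

text \<open>A new track guesses \<open>u\<close>: \<open>?a\<close> checks it against the diagram,
  \<open>?h\<close> writes it over the track of \<open>x\<close> to test \<open>P\<close>, and
  \<open>fst\<close> erases it. The guess fits because accepted strings are no longer than the
  diagram. The old value of \<open>x\<close> is kept, as the erased word must be
  \<open>encode bs v\<close>.\<close>

lemma recog_ex:
  assumes "recog G P" "g ` G \<subseteq> bounded_layers w"
  shows "recog G (\<lambda>bs v. \<exists>u\<in>odd_language (map g bs). P bs (v(x := u)))"
proof -
  obtain L where L: "fin_quot L" "\<And>bs v. bs \<in> lists G \<Longrightarrow> (\<And>x. length (v x) \<le> length bs) \<Longrightarrow>
      encode bs v \<in> L \<longleftrightarrow> P bs v"
    using assms(1) by (auto elim: recogE)
  let ?a = "\<lambda>((b, f), c). (g b, c)"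
  let ?h = "\<lambda>((b, f), c). (b, f(x := c))"
  show ?thesis
  proof (rule recogI[OF fin_quot_image[OF fin_quot_inter[OF
          fin_quot_vimage[OF fin_quot_accepted_words[of w], of ?a] fin_quot_vimage[OF L(1), of ?h]], of fst]])
    fix bs and v :: "nat \<Rightarrow> 'b list"
    assume bs: "bs \<in> lists G" and le: "\<And>x. length (v x) \<le> length bs"
    let ?n = "length bs"
    have len [simp]: "length (encode bs v) = ?n" by (simp add: encode_def)
    have a: "map ?a (zip (encode bs v) (padded ?n u)) = zip (map g bs) (padded (length (map g bs)) u)" for u
      by (intro nth_equalityI) (auto simp: encode_def)
    have h: "map ?h (zip (encode bs v) (padded ?n u)) = encode bs (v(x := u))" for u
      by (intro nth_equalityI) (auto simp: encode_def)
    have acc: "map ?a (zip (encode bs v) (padded ?n u)) \<in> accepted_words w \<longleftrightarrow> odd_accepts (map g bs) u"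
      if "length u \<le> ?n" for u
      unfolding a using bs assms(2) that by (intro accepted_words_iff) fastforce+
    have P: "map ?h (zip (encode bs v) (padded ?n u)) \<in> L \<longleftrightarrow> P bs (v(x := u))"
      if "length u \<le> ?n" for u
      unfolding h using that le by (intro L(2)[OF bs]) simp
    show "encode bs v \<in> map fst ` ({zs. map ?a zs \<in> accepted_words w} \<inter> {zs. map ?h zs \<in> L}) \<longleftrightarrow>
        (\<exists>u\<in>odd_language (map g bs). P bs (v(x := u)))" (is "?l \<longleftrightarrow> ?r")
    proof
      assume ?l
      then obtain zs where zs: "encode bs v = map fst zs" "map ?a zs \<in> accepted_words w" "map ?h zs \<in> L"
        by auto
      have "length zs = ?n" using zs(1) len by (metis length_map)
      \<comment> \<open>The guessed track is the padding of some string because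
        \<open>accepted_words\<close> demands it.\<close>
      with zs(2) obtain u where u: "length u \<le> ?n" "map snd (map ?a zs) = padded ?n u"
        by (auto simp: accepted_words_def odd_accepts_def simp del: map_map)
      have "map snd zs = padded ?n u" unfolding u(2)[symmetric] by (simp add: case_prod_unfold)
      then have "zs = zip (encode bs v) (padded ?n u)" using zs(1) by (metis zip_map_fst_snd)
      then show ?r using acc[OF u(1)] P[OF u(1)] zs by (auto simp: odd_language_def)
    next
      assume ?r
      then obtain u where u: "odd_accepts (map g bs) u" "P bs (v(x := u))" by (auto simp: odd_language_def)
      then have "length u \<le> ?n" by (simp add: odd_accepts_def)
      with u acc P have "zip (encode bs v) (padded ?n u) \<in> {zs. map ?a zs \<in> accepted_words w} \<inter> {zs. map ?h zs \<in> L}"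
        by simp
      moreover have "map fst (zip (encode bs v) (padded ?n u)) = encode bs v" by simp
      ultimately show ?l by (metis (no_types, lifting) imageI)
    qed
  qed
qed

text \<open>Induction on the formula. The structure may vary with the word, provided its domain and
  relations come from diagrams obtained by letter maps.\<close>

lemma recog_sat:
  assumes "fo_over ar \<phi>" "\<forall>a\<in>set ar. a \<ge> 1"
    and "g0 ` G \<subseteq> bounded_layers w" "\<And>i. i < length ar \<Longrightarrow> g i ` G \<subseteq> bounded_layers w"
    and "\<And>bs. domain (S bs) = odd_language (map g0 bs)"
    and "\<And>bs i. i < length ar \<Longrightarrow> interp (S bs) ! i = relation_of (ar ! i) (odd_language (map (g i) bs))"
  shows "recog G (\<lambda>bs v. sat (S bs) v \<phi>)"
  using assms(1)
proof (induction \<phi>)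
  case (Eq x y)
  show ?case by (simp add: recog_eq)
next
  case (Rel i xs)
  then have i: "i < length ar" "length xs = ar ! i" by auto
  then have "xs \<noteq> []" using assms(2) by (metis list.size(3) not_one_le_zero nth_mem)
  from recog_relation[OF assms(4)[OF i(1)] this] show ?case
    using i by (simp add: assms(6))
next
  case (Exists x f)
  then show ?case using recog_ex[OF _ assms(3)] by (simp add: assms(5))
next
  case (Forall x f)
  then have "recog G (\<lambda>bs v. sat (S bs) v f)" by simp
  from recog_not[OF recog_ex[OF recog_not[OF this] assms(3), of x]]
  show ?case by (simp add: assms(5))
qed (auto intro: recog_not recog_conj recog_disj)

section \<open>Sentences and finiteness of derived structures\<close>

lemma sat_cong_free_vars:
  "(\<And>x. x \<in> free_vars \<phi> \<Longrightarrow> v x = v' x) \<Longrightarrow> sat S v \<phi> \<longleftrightarrow> sat S v' \<phi>"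
proof (induction \<phi> arbitrary: v v')
  case (Rel i xs)
  then show ?case by (simp cong: map_cong)
next
  case (Exists x f)
  have "sat S (v(x := u)) f \<longleftrightarrow> sat S (v'(x := u)) f" for u
    by (rule Exists.IH) (use Exists.prems in auto)
  then show ?case by simp
next
  case (Forall x f)
  have "sat S (v(x := u)) f \<longleftrightarrow> sat S (v'(x := u)) f" for u
    by (rule Forall.IH) (use Forall.prems in auto)
  then show ?case by simp
next
  case (Conj f g)
  have "sat S v f \<longleftrightarrow> sat S v' f" "sat S v g \<longleftrightarrow> sat S v' g"
    using Conj.prems by (auto intro!: Conj.IH)
  then show ?case by simp
next
  case (Disj f g)
  have "sat S v f \<longleftrightarrow> sat S v' f" "sat S v g \<longleftrightarrow> sat S v' g"
    using Disj.prems by (auto intro!: Disj.IH)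
  then show ?case by simp
next
  case (Neg f)
  have "sat S v f \<longleftrightarrow> sat S v' f" using Neg.prems by (intro Neg.IH) simp
  then show ?case by simp
qed simp

text \<open>The nonempty domain provides at least one admissible valuation, and a sentence does not
  depend on the valuation; so \<open>v\<close> may even take values outside the domain, such as the
  constant \<open>[]\<close>.\<close>

lemma models_sentence_iff:
  assumes "finite_structure ar S" "free_vars \<phi> = {}"
  shows "models ar S \<phi> \<longleftrightarrow> sat S v \<phi>"
proof -
  obtain d where "d \<in> domain S" using assms(1) by (auto simp: finite_structure_def)
  then have "range (\<lambda>_::nat. d) \<subseteq> domain S" by auto
  moreover have "sat S v' \<phi> \<longleftrightarrow> sat S v \<phi>" for v'
    by (rule sat_cong_free_vars) (simp add: assms(2))
  ultimately show ?thesis using assms(1) unfolding models_def by blast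
qed

text \<open>The constant valuation \<open>[]\<close> fits words of every length, and encoding with
  it is a letter map that adds columns of \<open>None\<close>.\<close>

lemma fin_quot_recog:
  fixes P :: "'b list \<Rightarrow> (nat \<Rightarrow> 'a list) \<Rightarrow> bool"
  assumes "recog G P" shows "fin_quot {bs \<in> lists G. P bs (\<lambda>_. [])}"
proof -
  obtain L where L: "fin_quot L" "\<And>bs v. bs \<in> lists G \<Longrightarrow> (\<And>x. length (v x) \<le> length bs) \<Longrightarrow>
      encode bs v \<in> L \<longleftrightarrow> P bs v"
    using assms by (auto elim: recogE)
  have "encode bs (\<lambda>_. [] :: 'a list) = map (\<lambda>b. (b, \<lambda>_. None)) bs" for bs :: "'b list"
    by (intro nth_equalityI) (auto simp: encode_def padded_nth_def)
  then have "{bs \<in> lists G. P bs (\<lambda>_. [])} = lists G \<inter> {bs. map (\<lambda>b. (b, \<lambda>_. None)) bs \<in> L}"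
    using L(2)[of _ "\<lambda>_. []"] by auto
  then show ?thesis by (simp only:) (intro fin_quot_inter fin_quot_lists fin_quot_vimage L(1))
qed

lemma finite_odd_language:
  assumes "finite \<Sigma>" "D \<in> odds \<Sigma> w k" shows "finite (odd_language D)"
proof (rule finite_subset)
  show "finite {s. set s \<subseteq> \<Sigma> \<and> length s \<le> length D}"
    by (rule finite_lists_length_le[OF assms(1)])
  show "odd_language D \<subseteq> {s. set s \<subseteq> \<Sigma> \<and> length s \<le> length D}"
  proof
    fix s assume "s \<in> odd_language D"
    then obtain p q where le: "length s \<le> length D"
      and t: "\<forall>i<length D. (p i, padded_nth s i, q i) \<in> ltrans (D ! i)"
      by (auto simp: odd_language_def odd_accepts_def)
    have "s ! i \<in> \<Sigma>" if "i < length s" for i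
    proof -
      have "D ! i \<in> layers \<Sigma> w" using assms(2) le that by (auto simp: odds_def)
      then have "ltrans (D ! i) \<subseteq> lleft (D ! i) \<times> pad_alphabet \<Sigma> \<times> lright (D ! i)"
        by (simp add: layers_def)
      moreover have "(p i, padded_nth s i, q i) \<in> ltrans (D ! i)" using t le that by simp
      ultimately have "padded_nth s i \<in> pad_alphabet \<Sigma>" by blast
      then show ?thesis using that by (auto simp: padded_nth_def pad_alphabet_def)
    qed
    then show "s \<in> {s. set s \<subseteq> \<Sigma> \<and> length s \<le> length D}"
      using le by (auto simp: in_set_conv_nth)
  qed
qed

text \<open>By \<open>tensor_inj\<close>, a tuple whose tensor product lies in the power of
  \<open>M\<close> is the very tuple of members of \<open>M\<close> that witnesses this.\<close>

lemma relation_of_subset: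
  assumes "L \<subseteq> tensor_power_language M a" "a \<ge> 1"
  shows "relation_of a L \<subseteq> listset (replicate a M)"
proof
  fix us assume "us \<in> relation_of a L"
  then have us: "length us = a" "tensor us \<in> tensor_power_language M a"
    using assms(1) by (auto simp: relation_of_def)
  then obtain vs where vs: "vs \<in> listset (replicate a M)" "tensor us = tensor vs"
    by (auto simp: tensor_power_language_def tensor_language_def)
  have "length vs = a" using vs(1) by (simp add: listset_replicate)
  moreover have "us \<noteq> []" using us(1) assms(2) by auto
  ultimately have "us = vs" using tensor_inj[OF vs(2)] us(1) by simp
  then show "us \<in> listset (replicate a M)" using vs(1) by simp
qed

text \<open>Structurality already yields a finite domain and relations over it, so an automaton has
  only nonemptiness of the domain left to test.\<close>

lemma finite_structure_derived:
  assumes "(D0, Ds) \<in> structural C \<Sigma> w ar" "finite \<Sigma>" "\<forall>a\<in>set ar. a \<ge> 1"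
  shows "finite_structure ar (derived_structure ar (D0, Ds)) \<longleftrightarrow> odd_language D0 \<noteq> {}"
proof -
  have "finite (odd_language D0)" using assms finite_odd_language by (auto simp: structural_def)
  moreover have "relation_of (ar ! i) (odd_language (Ds ! i)) \<subseteq>
      listset (replicate (ar ! i) (odd_language D0))" if "i < length ar" for i
    using assms(1,3) that by (intro relation_of_subset) (auto simp: structural_def)
  ultimately show ?thesis
    using assms(1) by (auto simp: finite_structure_def derived_structure_def structural_def)
qed

subsection \<open>Structural tuples as words\<close>

definition base_layer :: "'a layer_symbol option list \<Rightarrow> 'a layer" where
  "base_layer b = projl (the (b ! 0))"

text \<open>Position 0 of a letter belongs to \<open>D0\<close>, hence the shift by one.\<close>

definition rel_layer :: "nat \<Rightarrow> 'a layer_symbol option list \<Rightarrow> 'a option list layer" where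
  "rel_layer i b = projr (the (b ! Suc i))"

definition split_tuple ::
    "nat \<Rightarrow> 'a layer_symbol option list list \<Rightarrow> 'a layer list \<times> 'a option list layer list list" where
  "split_tuple m bs = (map base_layer bs, map (\<lambda>i. map (rel_layer i) bs) [0..<m])"

text \<open>These are the columns without padding; no others occur, since the diagrams of a
  structural tuple have equal length.\<close>

definition full_letters ::
    "'a option set \<Rightarrow> 'a set \<Rightarrow> nat \<Rightarrow> nat list \<Rightarrow> 'a layer_symbol option list set" where
  "full_letters C \<Sigma> w ar = {Some (Inl B) # map (Some \<circ> Inr) Bs | B Bs.
     B \<in> layers \<Sigma> w \<and> length Bs = length ar \<and>
     (\<forall>i<length ar. Bs ! i \<in> layers (tensor_power_alphabet C (ar ! i)) w)}"

lemma full_letters_layers: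
  assumes "b \<in> full_letters C \<Sigma> w ar"
  shows "base_layer b \<in> layers \<Sigma> w"
    "i < length ar \<Longrightarrow> rel_layer i b \<in> layers (tensor_power_alphabet C (ar ! i)) w"
    "Some (Inl (base_layer b)) # map (\<lambda>i. Some (Inr (rel_layer i b))) [0..<length ar] = b"
proof -
  obtain B Bs where b: "b = Some (Inl B) # map (Some \<circ> Inr) Bs" "B \<in> layers \<Sigma> w"
    "length Bs = length ar" "\<forall>i<length ar. Bs ! i \<in> layers (tensor_power_alphabet C (ar ! i)) w"
    using assms unfolding full_letters_def by blast
  have base: "base_layer b = B" by (simp add: b(1) base_layer_def)
  have rel: "rel_layer i b = Bs ! i" if "i < length ar" for i
    using that by (simp add: b(1,3) rel_layer_def)
  show "base_layer b \<in> layers \<Sigma> w" using base b(2) by simp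
  show "i < length ar \<Longrightarrow> rel_layer i b \<in> layers (tensor_power_alphabet C (ar ! i)) w"
    using rel b(4) by simp
  have "map (\<lambda>i. Some (Inr (rel_layer i b))) [0..<length ar] = map (Some \<circ> Inr) Bs"
    using rel b(3) by (intro nth_equalityI) auto
  then show "Some (Inl (base_layer b)) # map (\<lambda>i. Some (Inr (rel_layer i b))) [0..<length ar] = b"
    using b(1) base by metis
qed

lemma tensor_tuple_strings:
  assumes "length D0 = k" "\<forall>D\<in>set Ds. length D = k"
  shows "tensor (tuple_strings (D0, Ds)) =
    map (\<lambda>j. Some (Inl (D0 ! j)) # map (\<lambda>D. Some (Inr (D ! j))) Ds) [0..<k]"
proof -
  have "length ` set (tuple_strings (D0, Ds)) = {k}"
    using assms by (auto simp: tuple_strings_def)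
  then have Max: "Max (length ` set (tuple_strings (D0, Ds))) = k" by simp
  show ?thesis unfolding tensor_def Max
    using assms by (intro map_cong) (simp_all add: tuple_strings_def padded_nth_def)
qed

lemma structural_lengths:
  assumes "(D0, Ds) \<in> structural C \<Sigma> w ar"
  shows "D0 \<noteq> []" "length Ds = length ar" "\<forall>D\<in>set Ds. length D = length D0"
    "set D0 \<subseteq> layers \<Sigma> w"
    "i < length ar \<Longrightarrow> set (Ds ! i) \<subseteq> layers (tensor_power_alphabet C (ar ! i)) w"
  using assms by (auto simp: structural_def odds_def in_set_conv_nth[of _ Ds])

text \<open>On words over full letters, \<open>split_tuple\<close> inverts the tensor product, so
  the image is described by a condition on words.\<close>

lemma tensor_structural_models:
  "tensor ` tuple_strings ` structural_models C \<Sigma> w ar \<phi> =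
   {bs \<in> lists (full_letters C \<Sigma> w ar). split_tuple (length ar) bs \<in> structural_models C \<Sigma> w ar \<phi>}"
  (is "?L = ?R")
proof (intro set_eqI iffI)
  fix bs assume "bs \<in> ?L"
  then obtain D0 Ds where D: "(D0, Ds) \<in> structural_models C \<Sigma> w ar \<phi>"
    "bs = tensor (tuple_strings (D0, Ds))" by auto
  then have s: "(D0, Ds) \<in> structural C \<Sigma> w ar" by (simp add: structural_models_def)
  note len = structural_lengths[OF s]
  have bs: "bs = map (\<lambda>j. Some (Inl (D0 ! j)) # map (\<lambda>D. Some (Inr (D ! j))) Ds) [0..<length D0]"
    unfolding D(2) using len by (intro tensor_tuple_strings) auto
  have "D0 ! j \<in> layers \<Sigma> w" "i < length ar \<Longrightarrow> Ds ! i ! j \<in> layers (tensor_power_alphabet C (ar ! i)) w"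
    if "j < length D0" for i j
    using len that by (auto intro!: subsetD[OF len(4)] subsetD[OF len(5)])
  then have "Some (Inl (D0 ! j)) # map (\<lambda>D. Some (Inr (D ! j))) Ds \<in> full_letters C \<Sigma> w ar"
    if "j < length D0" for j
    unfolding full_letters_def using that len(2)
    by (auto intro!: exI[of _ "D0 ! j"] exI[of _ "map (\<lambda>D. D ! j) Ds"])
  then have "bs \<in> lists (full_letters C \<Sigma> w ar)" unfolding bs by auto
  moreover have "split_tuple (length ar) bs = (D0, Ds)"
    using len by (auto simp: bs split_tuple_def base_layer_def rel_layer_def intro!: nth_equalityI)
  ultimately show "bs \<in> ?R" using D(1) by simp
next
  fix bs assume bs: "bs \<in> ?R"
  have "tensor (tuple_strings (split_tuple (length ar) bs)) =
      map (\<lambda>j. Some (Inl (base_layer (bs ! j))) #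
        map (\<lambda>i. Some (Inr (rel_layer i (bs ! j)))) [0..<length ar]) [0..<length bs]"
    unfolding split_tuple_def by (subst tensor_tuple_strings[of _ "length bs"]) auto
  also have "\<dots> = map (\<lambda>j. bs ! j) [0..<length bs]"
    using bs by (intro map_cong full_letters_layers(3)) auto
  also have "\<dots> = bs" by (rule map_nth)
  finally show "bs \<in> ?L" using bs by (metis (no_types, lifting) imageI mem_Collect_eq)
qed

lemma odds_length: "D \<in> odds \<Sigma> w k \<Longrightarrow> length D = k \<and> 1 \<le> k"
  by (simp add: odds_def)

text \<open>A finite intersection: \<open>base\<close> and \<open>rels\<close> say that the tracks
  are diagrams, \<open>sub\<close> gives the inclusions, and \<open>sats\<close> nonemptiness of the
  domain and truth of \<open>\<phi>\<close>. All tracks belong to one word, whose length is the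
  common length \<open>k\<close>.\<close>

lemma fin_quot_structural_models:
  fixes \<Sigma> :: "'a set"
  assumes "finite \<Sigma>" "\<forall>a\<in>set ar. a \<ge> 1" "fo_sentence ar \<phi>"
  shows "fin_quot {bs \<in> lists (full_letters C \<Sigma> w ar).
    split_tuple (length ar) bs \<in> structural_models C \<Sigma> w ar \<phi>}"
proof -
  define G where "G = full_letters C \<Sigma> w ar"
  define m where "m = length ar"
  define S where "S bs = derived_structure ar (split_tuple m bs)" for bs :: "'a layer_symbol option list list"
  define sats where "sats \<psi> = {bs \<in> lists G. sat (S bs) (\<lambda>_. []) \<psi>}" for \<psi>
  define sub where "sub i = {bs \<in> lists G. odd_language (map (rel_layer i) bs) \<subseteq>
      tensor_power_language (odd_language (map base_layer bs)) (ar ! i)}" for i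
  define rels where "rels i = {bs. map (rel_layer i) bs \<in>
      {D. D \<in> odds (tensor_power_alphabet C (ar ! i)) w (length D)}}" for i
  define base where "base = {bs. map base_layer bs \<in> {D. D \<in> odds \<Sigma> w (length D)}}"
  have b0: "base_layer ` G \<subseteq> bounded_layers w"
    using subsetD[OF layers_bounded full_letters_layers(1)] unfolding G_def by (rule image_subsetI)
  have b: "rel_layer i ` G \<subseteq> bounded_layers w" if "i < m" for i
    using subsetD[OF layers_bounded full_letters_layers(2)] that unfolding G_def m_def
    by (intro image_subsetI)
  have S: "domain (S bs) = odd_language (map base_layer bs)"
    "i < length ar \<Longrightarrow> interp (S bs) ! i = relation_of (ar ! i) (odd_language (map (rel_layer i) bs))"
    for bs i
    by (simp_all add: S_def m_def derived_structure_def split_tuple_def)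
  have fin_sats: "fin_quot (sats \<psi>)" if "fo_over ar \<psi>" for \<psi>
    using recog_sat[OF that assms(2) b0 b[unfolded m_def] S] unfolding sats_def by (rule fin_quot_recog)
  have struct: "split_tuple m bs \<in> structural C \<Sigma> w ar \<longleftrightarrow>
      bs \<in> base \<and> (\<forall>i<m. bs \<in> rels i \<and> bs \<in> sub i)" if bs: "bs \<in> lists G" for bs
  proof
    assume "split_tuple m bs \<in> structural C \<Sigma> w ar"
    then obtain k where k: "map base_layer bs \<in> odds \<Sigma> w k"
      "\<forall>i<m. map (rel_layer i) bs \<in> odds (tensor_power_alphabet C (ar ! i)) w k \<and>
        odd_language (map (rel_layer i) bs) \<subseteq>
        tensor_power_language (odd_language (map base_layer bs)) (ar ! i)"
      by (auto simp: structural_def split_tuple_def m_def)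
    have "k = length bs" using odds_length[OF k(1)] by simp
    then show "bs \<in> base \<and> (\<forall>i<m. bs \<in> rels i \<and> bs \<in> sub i)"
      using k bs by (simp add: base_def rels_def sub_def)
  next
    assume r: "bs \<in> base \<and> (\<forall>i<m. bs \<in> rels i \<and> bs \<in> sub i)"
    then have "map base_layer bs \<in> odds \<Sigma> w (length bs)" by (simp add: base_def)
    from odds_length[OF this] have "1 \<le> length bs" by blast
    then show "split_tuple m bs \<in> structural C \<Sigma> w ar"
      using r unfolding structural_def split_tuple_def
      by (simp add: base_def rels_def sub_def m_def) blast
  qed
  \<comment> \<open>The sentence \<open>\<exists>x. x = x\<close> expresses that the domain is nonempty.\<close>
  have models: "models ar (S bs) \<phi> \<longleftrightarrow> bs \<in> sats (Exists 0 (Eq 0 0)) \<and> bs \<in> sats \<phi>"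
    if "bs \<in> lists G" "split_tuple m bs \<in> structural C \<Sigma> w ar" for bs
  proof -
    have fs: "finite_structure ar (S bs) \<longleftrightarrow> odd_language (map base_layer bs) \<noteq> {}"
      using finite_structure_derived[OF that(2)[unfolded split_tuple_def] assms(1,2)]
      unfolding split_tuple_def S_def .
    have fv: "free_vars \<phi> = {}" using assms(3) by (simp add: fo_sentence_def)
    have sats: "bs \<in> sats \<psi> \<longleftrightarrow> sat (S bs) (\<lambda>_. []) \<psi>" for \<psi>
      using that(1) unfolding sats_def by blast
    have ne: "bs \<in> sats (Exists 0 (Eq 0 0)) \<longleftrightarrow> odd_language (map base_layer bs) \<noteq> {}"
      unfolding sats by (auto simp: S(1))
    show ?thesis
    proof (cases "finite_structure ar (S bs)")
      case True
      show ?thesis unfolding models_sentence_iff[OF True fv, of "\<lambda>_. []"] ne sats[of \<phi>]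
        using True fs by blast
    next
      case False
      then show ?thesis unfolding models_def ne using fs by blast
    qed
  qed
  have "{bs \<in> lists G. split_tuple m bs \<in> structural_models C \<Sigma> w ar \<phi>} =
      lists G \<inter> base \<inter> (\<Inter>i\<in>{..<m}. rels i \<inter> sub i) \<inter> sats (Exists 0 (Eq 0 0)) \<inter> sats \<phi>"
  proof (rule set_eqI)
    fix bs
    show "bs \<in> {bs \<in> lists G. split_tuple m bs \<in> structural_models C \<Sigma> w ar \<phi>} \<longleftrightarrow>
      bs \<in> lists G \<inter> base \<inter> (\<Inter>i\<in>{..<m}. rels i \<inter> sub i) \<inter> sats (Exists 0 (Eq 0 0)) \<inter> sats \<phi>"
      using struct[of bs] models[of bs]
      unfolding structural_models_def mem_Collect_eq Int_iff INT_iff lessThan_iff S_def Ball_def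
      by blast
  qed
  moreover have "fin_quot (sub i)" if "i < m" for i
    unfolding sub_def using assms(2) that 
    by (intro fin_quot_language_subset[OF _ b0 b[OF that]]) (simp add: m_def)
  moreover have "fin_quot (rels i)" "fin_quot base" for i
    unfolding rels_def base_def by (rule fin_quot_vimage[OF fin_quot_odds])+
  moreover have "fin_quot (sats (Exists 0 (Eq 0 0)))" "fin_quot (sats \<phi>)"
    using assms(3) by (auto intro!: fin_sats simp: fo_sentence_def)
  ultimately have "fin_quot {bs \<in> lists G. split_tuple m bs \<in> structural_models C \<Sigma> w ar \<phi>}"
    by (simp only:) (intro fin_quot_inter fin_quot_lists fin_quot_INT finite_lessThan; simp)
  then show ?thesis unfolding G_def m_def .
qed

text \<open>With \<open>C\<close> arbitrary, this covers both readings of the power alphabet at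
  once.\<close>

lemma regular_relation_structural_models:
  assumes "finite \<Sigma>" "\<forall>a\<in>set ar. a \<ge> 1" "fo_sentence ar \<phi>"
  shows "regular_relation (coordinate_alphabets C \<Sigma> w ar)
    (tuple_strings ` structural_models C \<Sigma> w ar \<phi>)"
proof -
  have sub: "tuple_strings ` structural_models C \<Sigma> w ar \<phi> \<subseteq>
      listset (map plus_strings (coordinate_alphabets C \<Sigma> w ar))"
  proof
    fix us assume "us \<in> tuple_strings ` structural_models C \<Sigma> w ar \<phi>"
    then obtain D0 Ds where us: "us = tuple_strings (D0, Ds)" and s: "(D0, Ds) \<in> structural C \<Sigma> w ar"
      by (auto simp: structural_models_def)
    note len = structural_lengths[OF s]
    have "map Inl D0 \<in> plus_strings (Inl ` layers \<Sigma> w)"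
      using len(1,4) by (auto simp: plus_strings_def subset_iff)
    moreover have "map Inr (Ds ! i) \<in> plus_strings (Inr ` layers (tensor_power_alphabet C (ar ! i)) w)"
      if "i < length ar" for i
    proof -
      have "length (Ds ! i) = length D0" using len(2,3) that by simp
      then have "Ds ! i \<noteq> []" using len(1) by auto
      then show ?thesis using len(5)[OF that] by (auto simp: plus_strings_def subset_iff)
    qed
    ultimately show "us \<in> listset (map plus_strings (coordinate_alphabets C \<Sigma> w ar))"
      using len(2) unfolding us listset_iff
      by (auto simp: tuple_strings_def coordinate_alphabets_def All_less_Suc2)
  qed
  have "fa_recognizable (tensor_alphabet (map pad_alphabet (coordinate_alphabets C \<Sigma> w ar)))
      (tensor ` tuple_strings ` structural_models C \<Sigma> w ar \<phi>)"
  proof (rule fin_quot_imp_fa_recognizable)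
    show "fin_quot (tensor ` tuple_strings ` structural_models C \<Sigma> w ar \<phi>)"
      unfolding tensor_structural_models by (rule fin_quot_structural_models[OF assms])
  qed (use sub tensor_in_lists in blast)
  with sub show ?thesis unfolding regular_relation_def by blast
qed

theorem theorem1:
  fixes \<Sigma> :: "'a set" and w :: nat and ar :: "nat list" and \<phi> :: fo
  assumes "finite \<Sigma>" and "w \<ge> 1" and "\<forall>a\<in>set ar. a \<ge> 1"
    and "fo_sentence ar \<phi>"
  shows "regular_relation (coordinate_alphabets (Some ` \<Sigma>) \<Sigma> w ar)
           (tuple_strings ` structural_models (Some ` \<Sigma>) \<Sigma> w ar \<phi>) \<and>
         regular_relation (coordinate_alphabets (pad_alphabet \<Sigma>) \<Sigma> w ar)
           (tuple_strings ` structural_models (pad_alphabet \<Sigma>) \<Sigma> w ar \<phi>)"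
  using regular_relation_structural_models[OF assms(1,3,4)] by blast

end
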